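(* Let $$\kappa_2=\frac{4\log\frac{5+\sqrt{29}}{2}-5\log(2+\sqrt5)}{\log\frac{5+\sqrt{29}}{2}-\log(2+\sqrt5)-\log\sqrt2}.$$ (i) Let $x\in(0,1)$ be an irrational number such that the derivative $?'(x)$ exists and $?'(x)=+\infty$. Then for any $t$ large enough one has $$\max_{u\le t}\left(\kappa_2u-S_x(u)\right)\ge\frac{\sqrt t}{10^8}.$$ (ii) There exists an irrational $x\in(0,1)$ such that $?'(x)=+\infty$ and for $t$ large enough one has $$\kappa_2t-S_x(t)\le200\sqrt t.$$
   Context: The Minkowski question mark function $?:[0,1]\to[0,1]$ is the continuous increasing function defined by $?(0)=0$, $?(1)=1$, by $?\left(\frac{p+p'}{q+q'}\right)=\frac12\left(?\left(\frac pq\right)+?\left(\frac{p'}{q'}\right)\right)$ for consecutive Farey fractions $\frac pq,\frac{p'}{q'}$, and extended by continuity to irrationals. Equivalently, for irrational $x=[0;a_1,a_2,\dots]$, $?(x)=\frac1{2^{a_1-1}}-\frac1{2^{a_1+a_2-1}}+\dots+\frac{(-1)^{n+1}}{2^{a_1+\dots+a_n-1}}+\cdots$. The derivative $?'(x)$ is understood as the limit of $\frac{?(x+\delta)-?(x)}{\delta}$ as $\delta\to0$ (two-sided), and the value $+\infty$ is allowed. For irrational $x\in(0,1)$ with regular continued fraction expansion $x=[0;a_1,a_2,\dots]$ (natural partial quotients), $S_x(t)=a_1+a_2+\dots+a_t$. Here $t,u$ range over natural numbers. Numerically $\kappa_2\approx4.401$. *)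

theory Defs
  imports "HOL-Analysis.Analysis"
begin

definition farey :: "nat \<Rightarrow> (nat \<times> nat) set" where
  "farey n = {(p, q). 1 \<le> q \<and> q \<le> n \<and> p \<le> q \<and> coprime p q}"

definition farey_consecutive :: "nat \<Rightarrow> nat \<Rightarrow> nat \<Rightarrow> nat \<Rightarrow> bool" where
  "farey_consecutive p q p' q' \<longleftrightarrow>
     (\<exists>n. (p, q) \<in> farey n \<and> (p', q') \<in> farey n \<and> real p / real q < real p' / real q' \<and>
          \<not> (\<exists>(a, b) \<in> farey n.
               real p / real q < real a / real b \<and> real a / real b < real p' / real q'))"

definition is_minkowski_qm :: "(real \<Rightarrow> real) \<Rightarrow> bool" where
  "is_minkowski_qm f \<longleftrightarrow>
     continuous_on {0..1} f \<and> strict_mono_on {0..1} f \<and> f 0 = 0 \<and> f 1 = 1 \<and>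
     (\<forall>p q p' q'. farey_consecutive p q p' q' \<longrightarrow>
        f ((real p + real p') / (real q + real q')) =
          (f (real p / real q) + f (real p' / real q')) / 2)"

text \<open>
  The defining conditions have a solution (\<open>is_minkowski_qm_minkowski_qm\<close> below), and it is
  unique on the unit interval (\<open>is_minkowski_qm_unique\<close>). Values outside the unit interval are
  unspecified.
\<close>

definition minkowski_qm :: "real \<Rightarrow> real" where
  "minkowski_qm = (SOME f. is_minkowski_qm f)"

text \<open>
  For \<open>x\<close> in the open unit interval, only values of \<open>f\<close> on the unit interval matter.
\<close>

definition has_deriv_pinfty :: "(real \<Rightarrow> real) \<Rightarrow> real \<Rightarrow> bool" where
  "has_deriv_pinfty f x \<longleftrightarrow> filterlim (\<lambda>\<delta>. (f (x + \<delta>) - f x) / \<delta>) at_top (at 0)"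

definition gauss_map :: "real \<Rightarrow> real" where
  "gauss_map x = frac (1 / x)"

text \<open>
  For irrational \<open>x = [0; a\<^sub>1, a\<^sub>2, \<dots>]\<close> in the open unit interval, \<open>cf_quot x i\<close> is \<open>a\<^sub>i\<close>. The
  index starts at 1; the value at \<open>i = 0\<close> is never used.
\<close>

definition cf_quot :: "real \<Rightarrow> nat \<Rightarrow> nat" where
  "cf_quot x i = nat \<lfloor>1 / (gauss_map ^^ (i - 1)) x\<rfloor>"

definition cf_sum :: "real \<Rightarrow> nat \<Rightarrow> nat" where
  "cf_sum x t = (\<Sum>i = 1..t. cf_quot x i)"

definition kappa2 :: real where
  "kappa2 = (4 * ln ((5 + sqrt 29) / 2) - 5 * ln (2 + sqrt 5)) /
            (ln ((5 + sqrt 29) / 2) - ln (2 + sqrt 5) - ln (sqrt 2))"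

lemma farey_consecutive_det:
  assumes "farey_consecutive p q p' q'"
  shows "p' * q = p * q' + 1"
proof -
  obtain n where n: "1 \<le> q" "q \<le> n" "p \<le> q" "coprime p q" "1 \<le> q'" "q' \<le> n" "p' \<le> q'"
      "coprime p' q'" "real p / real q < real p' / real q'"
    and nob: "\<And>a b. (a, b) \<in> farey n \<Longrightarrow> real p / real q < real a / real b \<Longrightarrow>
       \<not> real a / real b < real p' / real q'"
    using assms unfolding farey_consecutive_def farey_def by auto
  have "real p * real q' < real p' * real q"
    using n by (simp add: field_simps)
  hence "real (p * q') < real (p' * q)" by simp
  hence "p * q' < p' * q" by (simp only: of_nat_less_iff)
  hence lt: "int p * int q' < int p' * int q"
    by (simp flip: of_nat_mult)
  have "gcd (int p) (int q) = 1"
    using n(4) by simp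
  then obtain u v where uv: "u * int p + v * int q = 1"
    by (metis bezout_int)
  define k where "k = (int n + u) div int q"
  define y where "y = - u + k * int q"
  define x where "x = v + k * int p"
  have q0: "int q \<ge> 1" using n by simp
  have "k * int q \<le> int n + u" "int n + u < k * int q + int q"
    unfolding k_def
    using q0 div_mult_mod_eq[of "int n + u" "int q"] pos_mod_bound[of "int q" "int n + u"]
      pos_mod_sign[of "int q" "int n + u"] by linarith+
  hence y: "y \<le> int n" "int n < y + int q" unfolding y_def by auto
  have d: "x * int q - int p * y = 1" unfolding x_def y_def using uv by (simp add: algebra_simps)
  have y1: "y \<ge> 1" using y n by linarith
  have "int p' * int q \<le> int q' * int q" using n by (intro mult_right_mono) auto
  hence "int p * int q' < int q * int q'" using lt by (simp add: mult.commute)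
  hence "int p < int q" by (rule mult_right_less_imp_less) simp
  hence pq: "int p \<le> int q - 1" by simp
  have xy: "x \<le> y"
  proof (rule ccontr)
    assume "\<not> x \<le> y"
    hence "(y + 1) * int q \<le> x * int q" using q0 by (intro mult_right_mono) auto
    moreover have "int p * y \<le> (int q - 1) * y" using pq y1 by (intro mult_right_mono) auto
    ultimately show False using d q0 y1 by (simp add: algebra_simps)
  qed
  have x0: "x \<ge> 1"
  proof (rule ccontr)
    assume "\<not> x \<ge> 1"
    hence "x * int q \<le> 0" using q0 by (simp add: mult_nonpos_nonneg)
    moreover have "int p * y \<ge> 0" using y1 by simp
    ultimately show False using d by linarith
  qed
  have "coprime x y"
  proof (rule coprimeI)
    fix c assume "c dvd x" "c dvd y"
    hence "c dvd x * int q - int p * y" by simp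
    thus "c dvd 1" using d by simp
  qed
  hence F: "(nat x, nat y) \<in> farey n"
    unfolding farey_def using x0 y1 xy y
    by (auto simp: coprime_int_iff[symmetric] simp del: coprime_int_iff)
  have rd: "real_of_int x * real q - real p * real_of_int y = 1"
    using arg_cong[OF d, of real_of_int] by simp
  have "real p / real q < real (nat x) / real (nat y)"
    using rd n y1 x0 by (simp add: field_simps)
  with nob[OF F] have "\<not> real (nat x) / real (nat y) < real p' / real q'" by blast
  hence "real p' * real_of_int y \<le> real_of_int x * real q'"
    using n y1 x0 by (simp add: field_simps)
  hence "real_of_int (int p' * y) \<le> real_of_int (x * int q')" by simp
  hence E: "int p' * y \<le> x * int q'" by (simp only: of_int_le_iff)
  have id: "int q' = int q * (x * int q' - int p' * y) + y * (int p' * int q - int p * int q')"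
  proof -
    have "int q' * 1 = int q' * (x * int q - int p * y)" using d by simp
    thus ?thesis by (simp add: algebra_simps)
  qed
  have "x * int q' - int p' * y = 0"
  proof (rule ccontr)
    assume "x * int q' - int p' * y \<noteq> 0"
    hence "x * int q' - int p' * y \<ge> 1" using E by linarith
    hence "int q * (x * int q' - int p' * y) \<ge> int q * 1" using q0 by (intro mult_left_mono) auto
    moreover have "y * (int p' * int q - int p * int q') \<ge> y * 1"
      using lt y1 by (intro mult_left_mono) auto
    ultimately have "int q' \<ge> int q + y" using id by linarith
    thus False using y n by linarith
  qed
  hence e: "x * int q' = int p' * y" by simp
  hence "int q' = y * (int p' * int q - int p * int q')" using id by simp
  hence yd: "y dvd int q'" by (metis dvd_triv_left)
  have "int q' dvd y * int p'" using e by (metis dvd_triv_right mult.commute)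
  moreover have "coprime (int q') (int p')" using n(8) by (simp add: coprime_commute)
  ultimately have "int q' dvd y" by (simp add: coprime_dvd_mult_left_iff)
  hence "y = int q'" using yd y1 by (simp add: zdvd_antisym_nonneg)
  hence "int p' * int q - int p * int q' = 1"
    using id e y1 by simp
  hence "int (p' * q) = int (p * q' + 1)" by simp
  thus ?thesis by (simp only: of_nat_eq_iff)
qed

lemma det_farey_consecutive:
  assumes det: "p' * q = p * q' + 1" and q: "1 \<le> q" "1 \<le> q'" and p': "p' \<le> q'"
  shows "farey_consecutive p q p' q'"
proof -
  define n where "n = max q q'"
  have idet: "int p' * int q - int p * int q' = 1"
    using arg_cong[OF det, of int] by simp
  have c: "coprime p q" "coprime p' q'"
  proof -
    have "is_unit c" if "c dvd p' * q" "c dvd p * q'" for c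
      using that dvd_add_right_iff[of c "p * q'" 1] unfolding det by blast
    thus "coprime p q" "coprime p' q'" by (auto intro!: coprimeI)
  qed
  have pq: "p \<le> q"
  proof (rule ccontr)
    assume "\<not> p \<le> q"
    hence "q * q' \<le> p * q'" "p' * q \<le> q * q'" using p' by (simp_all add: mult.commute)
    thus False using det by linarith
  qed
  have rdet: "real p' * real q = real p * real q' + 1"
    using arg_cong[OF det, of real] by simp
  have lt: "real p / real q < real p' / real q'"
    using rdet q by (simp add: field_simps)
  have "False" if ab: "(a, b) \<in> farey n" "real p / real q < real a / real b"
      "real a / real b < real p' / real q'" for a b
  proof -
    have b: "b \<ge> 1" "b \<le> n" using ab unfolding farey_def by auto
    have "real p * real b < real a * real q" "real a * real q' < real p' * real b"
      using ab b q by (auto simp: field_simps)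
    hence "real (p * b) < real (a * q)" "real (a * q') < real (p' * b)" by simp_all
    hence "p * b < a * q" "a * q' < p' * b" by (simp_all only: of_nat_less_iff)
    hence 1: "int p * int b < int a * int q" "int a * int q' < int p' * int b"
      by (simp_all flip: of_nat_mult)
    have "int b * 1 = int b * (int p' * int q - int p * int q')" using idet by simp
    hence id: "int b = int q * (int p' * int b - int a * int q')
        + int q' * (int a * int q - int p * int b)"
      by (simp add: algebra_simps)
    have "int q * (int p' * int b - int a * int q') \<ge> int q * 1"
      "int q' * (int a * int q - int p * int b) \<ge> int q' * 1"
      using 1 by (intro mult_left_mono; simp)+
    hence "int b \<ge> int q + int q'" using id by linarith
    thus False using b q unfolding n_def by linarith
  qed
  moreover have "(p, q) \<in> farey n" "(p', q') \<in> farey n"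
    unfolding farey_def n_def using c pq p' q by auto
  ultimately show ?thesis
    unfolding farey_consecutive_def using lt by (intro exI[of _ n]) auto
qed

lemma farey_parents:
  fixes p q :: nat
  assumes c: "coprime p q" and q: "2 \<le> q" and p: "p \<le> q"
  obtains a b a' b' where "a' * b = a * b' + 1" "1 \<le> b" "1 \<le> b'" "a' \<le> b'"
    "p = a + a'" "q = b + b'"
proof -
  have "q \<noteq> p" "p \<noteq> 0"
    using c q by (auto intro: ccontr)
  hence p1: "1 \<le> int p" "int p < int q" using p by auto
  have "gcd (int p) (int q) = 1" using c by simp
  then obtain u v where uv: "u * int p + v * int q = 1" by (metis bezout_int)
  define y where "y = (- u) mod int q"
  have y: "0 \<le> y" "y < int q" unfolding y_def using q by auto
  have "int q dvd (- u) - y" unfolding y_def by (metis dvd_minus_mod)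
  then obtain k where k: "- u - y = int q * k" by blast
  define x where "x = v - k * int p"
  have u: "u = - y - int q * k" using k by linarith
  have d: "x * int q - int p * y = 1"
    using uv unfolding x_def u by (simp add: algebra_simps)
  have y1: "y \<ge> 1"
  proof (rule ccontr)
    assume "\<not> y \<ge> 1"
    hence "y = 0" using y by simp
    hence "x * int q = 1" using d by simp
    hence "int q dvd 1" by (metis dvd_triv_right)
    thus False using q by simp
  qed
  have x1: "x \<ge> 1"
  proof (rule ccontr)
    assume "\<not> x \<ge> 1"
    hence "x * int q \<le> 0" using q by (simp add: mult_nonpos_nonneg)
    moreover have "int p * y \<ge> 0" using y1 by simp
    ultimately show False using d by linarith
  qed
  have xp: "x \<le> int p"
  proof (rule ccontr)
    assume "\<not> x \<le> int p"
    hence "(int p + 1) * int q \<le> x * int q" using q by (intro mult_right_mono) auto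
    moreover have "int p * y \<le> int p * int q" using y by (intro mult_left_mono) auto
    ultimately show False using d q by (simp add: algebra_simps)
  qed
  have xy: "x \<le> y"
  proof (rule ccontr)
    assume "\<not> x \<le> y"
    hence "(y + 1) * int q \<le> x * int q" using q by (intro mult_right_mono) auto
    moreover have "int p * y \<le> (int q - 1) * y" using p1 y1 by (intro mult_right_mono) auto
    ultimately show False using d y1 q by (simp add: algebra_simps)
  qed
  have "x * (int q - y) = (int p - x) * y + 1" using d by (simp add: algebra_simps)
  hence "int (nat x * (q - nat y)) = int ((p - nat x) * nat y + 1)"
    using x1 xp y1 y by (simp add: of_nat_diff nat_le_iff)
  hence "nat x * (q - nat y) = (p - nat x) * nat y + 1" by (simp only: of_nat_eq_iff)
  thus ?thesis
    using that[of "nat x" "q - nat y" "p - nat x" "nat y"] x1 xp y1 y xy by auto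
qed

lemma is_minkowski_qm_unique:
  assumes f: "is_minkowski_qm f" and g: "is_minkowski_qm g" and x: "x \<in> {0..1}"
  shows "f x = g x"
proof -
  have rat: "f (real p / real q) = g (real p / real q)"
    if "coprime p q" "1 \<le> q" "p \<le> q" for p q
    using that
  proof (induction q arbitrary: p rule: less_induct)
    case (less q)
    show ?case
    proof (cases "q = 1")
      case True
      hence "p = 0 \<or> p = 1" using less.prems by auto
      thus ?thesis using True f g unfolding is_minkowski_qm_def by auto
    next
      case False
      hence "2 \<le> q" using less.prems by simp
      then obtain a b a' b' where ab: "a' * b = a * b' + 1" "1 \<le> b" "1 \<le> b'" "a' \<le> b'"
        and pq: "p = a + a'" "q = b + b'"
        using farey_parents less.prems by metis
      have fc: "farey_consecutive a b a' b'" using det_farey_consecutive ab by blast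
      have "coprime a b" "coprime a' b'" "a \<le> b"
        using fc unfolding farey_consecutive_def farey_def by auto
      hence "f (real a / real b) = g (real a / real b)"
        "f (real a' / real b') = g (real a' / real b')"
        using less.IH ab pq by auto
      moreover have "h (real p / real q) = (h (real a / real b) + h (real a' / real b')) / 2"
        if "is_minkowski_qm h" for h
        using that fc unfolding is_minkowski_qm_def pq of_nat_add by blast
      ultimately show ?thesis using f g by metis
    qed
  qed
  have eqQ: "f r = g r" if r: "r \<in> \<rat> \<inter> {0..1}" for r
  proof -
    obtain m n :: nat where mn: "n \<noteq> 0" "\<bar>r\<bar> = real m / real n" "coprime m n"
      using r Rats_abs_nat_div_natE[of r] by blast
    hence req: "r = real m / real n" using r by simp
    hence "real m \<le> real n" using r mn(1) by (simp add: divide_le_eq_1)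
    hence "r = real m / real n" "m \<le> n" using req by simp_all
    thus ?thesis using rat[of m n] mn by auto
  qed
  have cl: "x \<in> closure (\<rat> \<inter> {0..1})"
  proof (cases "x = 0")
    case True
    thus ?thesis using closure_subset[of "\<rat> \<inter> {0..1::real}"] by auto
  next
    case False
    show ?thesis unfolding closure_approachable
    proof safe
      fix e :: real assume "e > 0"
      hence "max 0 (x - e) < x" using x False by auto
      then obtain r where "r \<in> \<rat>" "max 0 (x - e) < r" "r < x"
        using Rats_dense_in_real by blast
      thus "\<exists>y\<in>\<rat> \<inter> {0..1}. dist y x < e"
        using x by (intro bexI[of _ r]) (auto simp: dist_real_def)
    qed
  qed
  have sub: "closure (\<rat> \<inter> {0..1}) \<subseteq> {0..1::real}"
    by (intro closure_minimal) auto
  have "continuous_on {0..1} (\<lambda>x. f x - g x)"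
    using f g unfolding is_minkowski_qm_def by (intro continuous_intros) auto
  hence "continuous_on (closure (\<rat> \<inter> {0..1})) (\<lambda>x. f x - g x)"
    using continuous_on_subset sub by blast
  from continuous_constant_on_closure[OF this, of 0] eqQ cl show ?thesis by auto
qed

text \<open>
  The function is obtained as the uniform limit of the iterates, started at the identity, of the
  operator given by the self-similarities \<open>?(x) = ?(x / (1 - x)) / 2\<close> on the left half and
  \<open>?(x) = 1/2 + ?(2 - 1/x) / 2\<close> on the right half of the unit interval.
\<close>

primrec qm_approx :: "nat \<Rightarrow> real \<Rightarrow> real" where
  "qm_approx 0 x = x"
| "qm_approx (Suc n) x =
     (if x \<le> 1/2 then qm_approx n (x / (1 - x)) / 2 else 1/2 + qm_approx n (2 - 1/x) / 2)"

lemma qm_map_left: "0 \<le> x \<Longrightarrow> x \<le> 1/2 \<Longrightarrow> x / (1 - x) \<in> {0..1::real}"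
  by (auto simp: field_simps)

lemma qm_map_right: "1/2 \<le> x \<Longrightarrow> x \<le> 1 \<Longrightarrow> 2 - 1/x \<in> {0..1::real}"
  by (auto simp: field_simps)

lemma qm_approx_01: "qm_approx n 0 = 0" "qm_approx n 1 = 1"
  by (induction n) auto

lemma qm_approx_range: "x \<in> {0..1} \<Longrightarrow> qm_approx n x \<in> {0..1}"
proof (induction n arbitrary: x)
  case (Suc n)
  show ?case
  proof (cases "x \<le> 1/2")
    case True
    thus ?thesis using Suc.IH[OF qm_map_left[of x]] Suc.prems by auto
  next
    case False
    thus ?thesis using Suc.IH[OF qm_map_right[of x]] Suc.prems by auto
  qed
qed auto

lemma qm_approx_mono: "0 \<le> x \<Longrightarrow> x \<le> y \<Longrightarrow> y \<le> 1 \<Longrightarrow> qm_approx n x \<le> qm_approx n y"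
proof (induction n arbitrary: x y)
  case (Suc n)
  consider "y \<le> 1/2" | "x \<le> 1/2" "y > 1/2" | "x > 1/2" by linarith
  thus ?case
  proof cases
    case 1
    have "x / (1 - x) \<le> y / (1 - y)" using Suc.prems 1 by (intro frac_le) auto
    moreover have "x / (1 - x) \<in> {0..1}" "y / (1 - y) \<in> {0..1}"
      using qm_map_left Suc.prems 1 by auto
    ultimately show ?thesis using Suc.IH Suc.prems 1 by auto
  next
    case 2
    have "qm_approx n (x / (1 - x)) \<in> {0..1}" "qm_approx n (2 - 1/y) \<in> {0..1}"
      using qm_approx_range qm_map_left qm_map_right Suc.prems 2 by auto
    thus ?thesis using 2 by auto
  next
    case 3
    have "2 - 1/x \<le> 2 - 1/y" using Suc.prems 3 by (auto simp: field_simps)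
    moreover have "2 - 1/x \<in> {0..1}" "2 - 1/y \<in> {0..1}"
      using qm_map_right Suc.prems 3 by auto
    ultimately show ?thesis using Suc.IH Suc.prems 3 by auto
  qed
qed auto

lemma qm_approx_cont: "continuous_on {0..1} (qm_approx n)"
proof (induction n)
  case 0
  have "qm_approx 0 = (\<lambda>x. x)" by auto
  thus ?case by simp
next
  case (Suc n)
  have l: "continuous_on {x \<in> {0..1}. x \<le> 1/2} (\<lambda>x. qm_approx n (x / (1 - x)) / 2)"
    using qm_map_left
    by (intro continuous_intros continuous_on_compose2[OF Suc.IH]) auto
  have r: "continuous_on {x \<in> {0..1}. 1/2 \<le> x} (\<lambda>x. 1/2 + qm_approx n (2 - 1/x) / 2)"
    using qm_map_right
    by (intro continuous_intros continuous_on_compose2[OF Suc.IH]) auto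
  have half: "x / (1 - x) = 1" "2 - 1 / x = 0" if "x * 2 = 1" for x :: real
    using that by (auto simp: field_simps)
  have "continuous_on {0..1} (\<lambda>x. if x \<le> 1/2 then qm_approx n (x / (1 - x)) / 2
      else 1/2 + qm_approx n (2 - 1/x) / 2)"
    by (rule continuous_on_cases_le[OF l r]) (auto simp: qm_approx_01 half)
  thus ?case by (simp cong: continuous_on_cong)
qed

lemma qm_approx_step: "x \<in> {0..1} \<Longrightarrow> \<bar>qm_approx (Suc n) x - qm_approx n x\<bar> \<le> (1/2) ^ n"
proof (induction n arbitrary: x)
  case 0
  thus ?case using qm_approx_range[of x 0] qm_approx_range[of x "Suc 0"]
    by (simp del: qm_approx.simps add: abs_le_iff)
next
  case (Suc n)
  show ?case
  proof (cases "x \<le> 1/2")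
    case True
    have "\<bar>qm_approx (Suc n) (x / (1 - x)) - qm_approx n (x / (1 - x))\<bar> \<le> (1/2) ^ n"
      using Suc.IH[OF qm_map_left[of x]] Suc.prems True by auto
    moreover have "qm_approx (Suc (Suc n)) x = qm_approx (Suc n) (x / (1 - x)) / 2"
      "qm_approx (Suc n) x = qm_approx n (x / (1 - x)) / 2"
      using True by (simp_all only: qm_approx.simps if_True)
    ultimately show ?thesis by (simp only: power_Suc abs_le_iff) argo
  next
    case False
    have "\<bar>qm_approx (Suc n) (2 - 1/x) - qm_approx n (2 - 1/x)\<bar> \<le> (1/2) ^ n"
      using Suc.IH[OF qm_map_right[of x]] Suc.prems False by auto
    moreover have "qm_approx (Suc (Suc n)) x = 1/2 + qm_approx (Suc n) (2 - 1/x) / 2"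
      "qm_approx (Suc n) x = 1/2 + qm_approx n (2 - 1/x) / 2"
      using False by (simp_all only: qm_approx.simps if_False)
    ultimately show ?thesis by (simp only: power_Suc abs_le_iff) argo
  qed
qed

lemma qm_exists_self_similar:
  obtains f :: "real \<Rightarrow> real" where "continuous_on {0..1} f"
    "\<And>x y. 0 \<le> x \<Longrightarrow> x \<le> y \<Longrightarrow> y \<le> 1 \<Longrightarrow> f x \<le> f y" "f 0 = 0" "f 1 = 1"
    "\<And>x. 0 \<le> x \<Longrightarrow> x \<le> 1/2 \<Longrightarrow> f x = f (x / (1 - x)) / 2"
    "\<And>x. 1/2 \<le> x \<Longrightarrow> x \<le> 1 \<Longrightarrow> f x = 1/2 + f (2 - 1/x) / 2"
proof -
  define d where "d = (\<lambda>i x. qm_approx (Suc i) x - qm_approx i x)"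
  define f where "f = (\<lambda>x. x + (\<Sum>i. d i x))"
  have "uniform_limit {0..1} (\<lambda>n x. \<Sum>i<n. d i x) (\<lambda>x. \<Sum>i. d i x) sequentially"
    unfolding d_def using qm_approx_step
    by (intro Weierstrass_m_test[where M = "\<lambda>n. (1/2) ^ n"])
       (auto simp del: qm_approx.simps intro: summable_geometric)
  hence "uniform_limit {0..1} (\<lambda>n x. x + (\<Sum>i<n. d i x)) f sequentially"
    unfolding f_def by (intro uniform_limit_intros)
  moreover have "x + (\<Sum>i<n. d i x) = qm_approx n x" for n x
    unfolding d_def by (induction n) (auto simp del: qm_approx.simps(2))
  ultimately have ul: "uniform_limit {0..1} qm_approx f sequentially" by simp
  have lim: "(\<lambda>n. qm_approx n x) \<longlonglongrightarrow> f x" if "x \<in> {0..1}" for x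
    using tendsto_uniform_limitI[OF ul that] .
  show ?thesis
  proof
    show "continuous_on {0..1} f"
      by (rule uniform_limit_theorem[OF _ ul]) (auto simp: qm_approx_cont)
    show "f x \<le> f y" if "0 \<le> x" "x \<le> y" "y \<le> 1" for x y
      by (rule LIMSEQ_le[OF lim lim]) (use that qm_approx_mono in auto)
    show "f 0 = 0" "f 1 = 1"
      using lim[of 0] lim[of 1] by (auto simp: qm_approx_01 LIMSEQ_const_iff)
    show "f x = f (x / (1 - x)) / 2" if x: "0 \<le> x" "x \<le> 1/2" for x
    proof -
      have "(\<lambda>n. qm_approx n (x / (1 - x)) / 2) \<longlonglongrightarrow> f (x / (1 - x)) / 2"
        using qm_map_left[OF x] by (intro tendsto_divide lim) auto
      moreover have "(\<lambda>n. qm_approx (Suc n) x) \<longlonglongrightarrow> f x"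
        using x by (intro LIMSEQ_Suc lim) auto
      moreover have "qm_approx (Suc n) x = qm_approx n (x / (1 - x)) / 2" for n
        using x by simp
      ultimately show ?thesis by (simp only:) (rule LIMSEQ_unique)
    qed
    show "f x = 1/2 + f (2 - 1/x) / 2" if x: "1/2 \<le> x" "x \<le> 1" for x
    proof -
      have "(\<lambda>n. 1/2 + qm_approx n (2 - 1/x) / 2) \<longlonglongrightarrow> 1/2 + f (2 - 1/x) / 2"
        using qm_map_right[OF x] by (intro tendsto_divide tendsto_add lim) auto
      moreover have "(\<lambda>n. qm_approx (Suc n) x) \<longlonglongrightarrow> f x"
        using x by (intro LIMSEQ_Suc lim) auto
      moreover have "qm_approx (Suc n) x = 1/2 + qm_approx n (2 - 1/x) / 2" for n
      proof (cases "x = 1/2")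
        case True
        show ?thesis unfolding True by (simp add: qm_approx_01)
      next
        case False
        thus ?thesis using x by simp
      qed
      ultimately show ?thesis by (simp only:) (rule LIMSEQ_unique)
    qed
  qed
qed

lemma self_similar_mediant:
  fixes f :: "real \<Rightarrow> real"
  assumes f01: "f 0 = 0" "f 1 = 1"
    and fl: "\<And>x. 0 \<le> x \<Longrightarrow> x \<le> 1/2 \<Longrightarrow> f x = f (x / (1 - x)) / 2"
    and fr: "\<And>x. 1/2 \<le> x \<Longrightarrow> x \<le> 1 \<Longrightarrow> f x = 1/2 + f (2 - 1/x) / 2"
    and det: "p' * q = p * q' + 1" and q: "1 \<le> q" "1 \<le> q'" and p': "p' \<le> q'"
  shows "f (real p / real q) < f (real p' / real q') \<and>
    f (real (p + p') / real (q + q')) = (f (real p / real q) + f (real p' / real q')) / 2"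
proof -
  have L: "f (real a / real b) = f (real a / real (b - a)) / 2" if "1 \<le> b" "2 * a \<le> b" for a b
  proof -
    have "real a / real b / (1 - real a / real b) = real a / real (b - a)"
      using that by (auto simp: field_simps of_nat_diff)
    thus ?thesis using fl[of "real a / real b"] that by (auto simp: field_simps)
  qed
  have R: "f (real a / real b) = 1/2 + f (real (2 * a - b) / real a) / 2"
    if "1 \<le> a" "b \<le> 2 * a" "a \<le> b" for a b
  proof -
    have "2 - 1 / (real a / real b) = real (2 * a - b) / real a"
      using that by (auto simp: field_simps of_nat_diff)
    thus ?thesis using fr[of "real a / real b"] that by (auto simp: field_simps)
  qed
  show ?thesis using det q p'
  proof (induction "q + q'" arbitrary: p q p' q' rule: less_induct)
    case less
    note det = less.prems(1) and q = less.prems(2,3) and p' = less.prems(4)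
    have p'1: "1 \<le> p'" using det by (cases p') auto
    have "farey_consecutive p q p' q'" using det_farey_consecutive less.prems by blast
    hence pq: "p \<le> q" unfolding farey_consecutive_def farey_def by auto
    have pltq: "p < q"
    proof (rule ccontr)
      assume "\<not> p < q"
      hence "p = q" using pq by simp
      hence "p' * p = q' * p + 1" using det by (simp add: mult.commute)
      thus False using p' by (metis add_le_same_cancel1 mult_le_mono1 not_one_le_zero)
    qed
    have idet: "int p' * int q = int p * int q' + 1"
      using arg_cong[OF det, of int] by simp
    consider (l) "2 * p' \<le> q'" | (r) "q \<le> 2 * p" | (m) "q' < 2 * p'" "2 * p < q" by linarith
    thus ?case
    proof cases
      case l
      have lp: "2 * p \<le> q"
      proof (rule ccontr)
        assume "\<not> 2 * p \<le> q"
        hence "int q * int q' \<le> (2 * int p) * int q'" by (intro mult_right_mono) auto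
        moreover have "(2 * int p') * int q \<le> int q' * int q" using l by (intro mult_right_mono) auto
        ultimately show False using idet unfolding mult.assoc mult.commute[of "int q'" "int q"] by linarith
      qed
      have "int (p' * (q - p)) = int (p * (q' - p') + 1)"
        using pq p' idet by (simp add: of_nat_diff algebra_simps)
      hence "p' * (q - p) = p * (q' - p') + 1" by (simp only: of_nat_eq_iff)
      hence IH: "f (real p / real (q - p)) < f (real p' / real (q' - p')) \<and>
        f (real (p + p') / real ((q - p) + (q' - p'))) =
          (f (real p / real (q - p)) + f (real p' / real (q' - p'))) / 2"
        using less.hyps[of "q - p" "q' - p'" p' p] pltq p'1 l q by auto
      have "(q - p) + (q' - p') = (q + q') - (p + p')" using pq p' by simp
      thus ?thesis using IH L[of q p] L[of q' p'] L[of "q + q'" "p + p'"] l lp q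
        by (auto simp: field_simps simp del: of_nat_add)
    next
      case r
      have p1: "1 \<le> p" using r q by simp
      have rp': "q' \<le> 2 * p'"
      proof (rule ccontr)
        assume "\<not> q' \<le> 2 * p'"
        hence "(2 * int p') * int q \<le> int q' * int q" by (intro mult_right_mono) auto
        moreover have "int q * int q' \<le> (2 * int p) * int q'" using r by (intro mult_right_mono) auto
        ultimately show False using idet unfolding mult.assoc mult.commute[of "int q'" "int q"] by linarith
      qed
      have "int ((2 * p' - q') * p) = int ((2 * p - q) * p' + 1)"
        using r rp' idet by (simp add: of_nat_diff algebra_simps)
      hence "(2 * p' - q') * p = (2 * p - q) * p' + 1" by (simp only: of_nat_eq_iff)
      hence IH: "f (real (2 * p - q) / real p) < f (real (2 * p' - q') / real p') \<and>
        f (real ((2 * p - q) + (2 * p' - q')) / real (p + p')) =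
          (f (real (2 * p - q) / real p) + f (real (2 * p' - q') / real p')) / 2"
        using less.hyps[of p p' "2 * p' - q'" "2 * p - q"] pltq p'1 p1 p' by auto
      have "(2 * p - q) + (2 * p' - q') = 2 * (p + p') - (q + q')" using r rp' by simp
      thus ?thesis using IH R[of p q] R[of p' q'] R[of "p + p'" "q + q'"] r rp' p1 p'1 p' pq
        by (auto simp: field_simps simp del: of_nat_add)
    next
      case m
      have "int q * 1 \<le> int q * (2 * int p' - int q')" "int q' * 1 \<le> int q' * (int q - 2 * int p)"
        using m by (intro mult_left_mono; linarith)+
      moreover have "int q * (2 * int p' - int q') + int q' * (int q - 2 * int p) = 2"
        using idet by (simp add: algebra_simps)
      ultimately have "q = 1" "q' = 1" using q by linarith+
      moreover from this have "p = 0" "p' = 1" using pltq p' p'1 by auto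
      ultimately show ?thesis using f01 fl[of "1/2"] by simp
    qed
  qed
qed

lemma farey_pair_between:
  assumes "0 \<le> x" "x < y" "y \<le> 1"
  obtains p q p' q' where "p' * q = p * q' + 1" "1 \<le> q" "1 \<le> q'" "p' \<le> q'"
    "x \<le> real p / real q" "real p' / real q' \<le> y"
proof -
  obtain r where r: "r \<in> \<rat>" "x < r" "r < y" using Rats_dense_in_real assms by blast
  obtain p q :: nat where pq: "q \<noteq> 0" "\<bar>r\<bar> = real p / real q" "coprime p q"
    using Rats_abs_nat_div_natE[OF r(1)] by metis
  have req: "r = real p / real q" using pq r assms by simp
  have "gcd (int p) (int q) = 1" using pq(3) by simp
  then obtain u v where uv: "u * int p + v * int q = 1" by (metis bezout_int)
  obtain N :: nat where N: "1 / (y - r) < real N" using reals_Archimedean2 by blast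
  define k where "k = \<bar>u\<bar> + int N + 1"
  define q' where "q' = k * int q - u"
  define p' where "p' = k * int p + v"
  have d: "p' * int q = int p * q' + 1" unfolding p'_def q'_def using uv by (simp add: algebra_simps)
  have "k * 1 \<le> k * int q" using pq(1) unfolding k_def by (intro mult_left_mono) auto
  hence q'N: "q' \<ge> int N + 1" unfolding q'_def using k_def by linarith
  have p'1: "p' \<ge> 1"
  proof (rule ccontr)
    assume "\<not> p' \<ge> 1"
    hence "p' * int q \<le> 0" by (simp add: mult_nonpos_nonneg)
    moreover have "int p * q' \<ge> 0" using q'N by simp
    ultimately show False using d by linarith
  qed
  have rd: "real_of_int p' * real q = real p * real_of_int q' + 1"
    using arg_cong[OF d, of real_of_int] by simp
  have "real_of_int p' / real_of_int q' = r + 1 / (real q * real_of_int q')"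
    unfolding req using rd q'N pq(1) by (simp add: field_simps)
  also have "\<dots> \<le> r + (y - r)"
  proof -
    have "real N \<le> real_of_int q'" using q'N by linarith
    also have "\<dots> \<le> real q * real_of_int q'" using q'N pq(1) by simp
    finally have "1 / (y - r) \<le> real q * real_of_int q'" using N by linarith
    hence "1 / (real q * real_of_int q') \<le> y - r"
      using le_imp_inverse_le[of "1 / (y - r)" "real q * real_of_int q'"] r
      by (simp add: inverse_eq_divide)
    thus ?thesis by simp
  qed
  finally have le: "real_of_int p' / real_of_int q' \<le> y" by simp
  hence "real_of_int p' / real_of_int q' \<le> 1" using assms by simp
  hence "p' \<le> q'" using q'N by (simp add: field_simps)
  moreover have "int (nat p' * q) = int (p * nat q' + 1)" using d p'1 q'N by simp
  hence "nat p' * q = p * nat q' + 1" by (simp only: of_nat_eq_iff)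
  ultimately show ?thesis
    using that[of "nat p'" q p "nat q'"] le r req pq(1) p'1 q'N by auto
qed

lemma ex_is_minkowski_qm: "\<exists>f. is_minkowski_qm f"
proof -
  obtain f :: "real \<Rightarrow> real" where cont: "continuous_on {0..1} f"
    and mono: "\<And>x y. 0 \<le> x \<Longrightarrow> x \<le> y \<Longrightarrow> y \<le> 1 \<Longrightarrow> f x \<le> f y" and f01: "f 0 = 0" "f 1 = 1"
    and fl: "\<And>x. 0 \<le> x \<Longrightarrow> x \<le> 1/2 \<Longrightarrow> f x = f (x / (1 - x)) / 2"
    and fr: "\<And>x. 1/2 \<le> x \<Longrightarrow> x \<le> 1 \<Longrightarrow> f x = 1/2 + f (2 - 1/x) / 2"
    using qm_exists_self_similar by blast
  have med: "f (real p / real q) < f (real p' / real q') \<and>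
      f (real (p + p') / real (q + q')) = (f (real p / real q) + f (real p' / real q')) / 2"
    if "p' * q = p * q' + 1" "1 \<le> q" "1 \<le> q'" "p' \<le> q'" for p q p' q'
    using self_similar_mediant[of f p' q p q'] f01 fl fr that by blast
  have "strict_mono_on {0..1} f"
  proof (rule strict_mono_onI)
    fix x y :: real assume xy: "x \<in> {0..1}" "y \<in> {0..1}" "x < y"
    then obtain p q p' q' where pq: "p' * q = p * q' + 1" "1 \<le> q" "1 \<le> q'" "p' \<le> q'"
      "x \<le> real p / real q" "real p' / real q' \<le> y"
      using farey_pair_between[of x y] unfolding atLeastAtMost_iff by metis
    have fc: "farey_consecutive p q p' q'" using det_farey_consecutive pq by blast
    hence "p \<le> q" unfolding farey_consecutive_def farey_def by auto
    hence "f x \<le> f (real p / real q)" using pq xy by (intro mono) auto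
    also have "\<dots> < f (real p' / real q')" using med[OF pq(1-4)] by blast
    also have "\<dots> \<le> f y" using pq xy by (intro mono) auto
    finally show "f x < f y" .
  qed
  moreover have "f ((real p + real p') / (real q + real q')) =
      (f (real p / real q) + f (real p' / real q')) / 2"
    if fc: "farey_consecutive p q p' q'" for p q p' q'
  proof -
    have "1 \<le> q" "1 \<le> q'" "p' \<le> q'"
      using fc unfolding farey_consecutive_def farey_def by auto
    thus ?thesis using med[OF farey_consecutive_det[OF fc]] by simp
  qed
  ultimately have "is_minkowski_qm f" unfolding is_minkowski_qm_def using cont f01 by blast
  thus ?thesis by blast
qed

theorem is_minkowski_qm_minkowski_qm: "is_minkowski_qm minkowski_qm"
  unfolding minkowski_qm_def using ex_is_minkowski_qm by (rule someI_ex)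

end

theory Submission
  imports Defs
begin

text \<open>
  Appending a digit \<open>a\<close> to a continued fraction multiplies the vector of the last two convergent
  denominators by a symmetric matrix of spectral norm \<open>\<lambda>\<^sub>a = (a + \<surd>(a\<^sup>2 + 4)) / 2\<close>, so that \<open>log q\<^sub>t\<close> is
  at most \<open>\<Sum> log \<lambda>\<^sub>a\<close>. By concavity, at integers \<open>log \<lambda>\<^sub>a\<close> is at most the chord through the digits 4 and 5, and
  the constant \<open>\<kappa>\<^sub>2\<close> is the digit average for which the chord equals \<open>a log \<surd>2\<close>. A constant factor is
  lost at every digit other than 4 and 5 and at every switch between 4 and 5.

  Comparing \<open>?\<close> at consecutive convergents shows that \<open>?'(x) = +\<infinity>\<close> forces \<open>2 q\<^sub>t q\<^sub>t\<^sub>-\<^sub>1 \<ge> 2 ^ S\<^sub>x(t)\<close> for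
  large \<open>t\<close>. So \<open>\<kappa>\<^sub>2 t - S\<^sub>x(t)\<close> must pay for all losses up to \<open>t\<close>; but it changes linearly along a
  constant stretch of 4s or 5s. If it stayed below \<open>M\<close>, there would be a loss in every window of
  length proportional to \<open>M\<close>, hence of order \<open>t / M\<close> losses, and \<open>M\<close> is at least of order \<open>\<surd>t\<close>.

  Conversely, blocks of 4s followed by 5s with lengths growing linearly have about \<open>\<surd>t\<close> switches up
  to \<open>t\<close>, each of bounded cost, and the excursions of \<open>\<kappa>\<^sub>2 t - S\<^sub>x(t)\<close> inside the blocks are of order \<open>\<surd>t\<close>.
\<close>

section \<open>Growth of convergent denominators\<close>

text \<open>Indices are shifted by one against the usual \<open>p\<^sub>n / q\<^sub>n\<close>: \<open>cf_den a (Suc n)\<close> is \<open>q\<^sub>n\<close>, so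
  that \<open>cf_den a 0\<close> is \<open>q\<close> at index \<open>-1\<close>. The value \<open>a 0\<close> is never used.\<close>

fun cf_num :: "(nat \<Rightarrow> nat) \<Rightarrow> nat \<Rightarrow> nat" where
  "cf_num a 0 = 1"
| "cf_num a (Suc 0) = 0"
| "cf_num a (Suc (Suc n)) = a (Suc n) * cf_num a (Suc n) + cf_num a n"

fun cf_den :: "(nat \<Rightarrow> nat) \<Rightarrow> nat \<Rightarrow> nat" where
  "cf_den a 0 = 0"
| "cf_den a (Suc 0) = 1"
| "cf_den a (Suc (Suc n)) = a (Suc n) * cf_den a (Suc n) + cf_den a n"

text \<open>The dominant eigenvalue, and hence the spectral norm, of the symmetric matrix with rows
  \<open>(n, 1)\<close> and \<open>(1, 0)\<close> that appends the digit \<open>n\<close> to a continuant.\<close>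

definition lam :: "nat \<Rightarrow> real" where
  "lam n = (real n + sqrt ((real n)\<^sup>2 + 4)) / 2"

lemma lam_pos [simp]: "lam n > 0"
  unfolding lam_def by (simp add: add_nonneg_pos)

lemma lam_nonzero [simp]: "lam n \<noteq> 0"
  using lam_pos[of n] by linarith

lemma lam_square: "(lam n)\<^sup>2 = real n * lam n + 1"
proof -
  have "(sqrt ((real n)\<^sup>2 + 4))\<^sup>2 = (real n)\<^sup>2 + 4" by simp
  thus ?thesis unfolding lam_def by (simp add: power2_eq_square field_simps)
qed

text \<open>\<open>lam n\<close> is the larger root of \<open>r\<^sup>2 - n * r - 1\<close>; to the
  right of the vertex \<open>n / 2\<close> the sign of this polynomial locates
  \<open>r\<close>.\<close>

lemma lam_le: "lam n \<le> r" if "0 \<le> 2 * r - n" "1 + n * r \<le> r\<^sup>2" for r :: real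
proof -
  have "sqrt ((real n)\<^sup>2 + 4) \<le> 2 * r - n"
    using that by (intro real_le_lsqrt) (auto simp: power2_eq_square algebra_simps)
  thus ?thesis unfolding lam_def by simp
qed

lemma lam_ge: "r \<le> lam n" if "r\<^sup>2 \<le> 1 + n * r" for r :: real
proof -
  have "2 * r - n \<le> sqrt ((real n)\<^sup>2 + 4)"
    using that by (intro real_le_rsqrt) (auto simp: power2_eq_square algebra_simps)
  thus ?thesis unfolding lam_def by simp
qed

lemma lam_bounds:
  "lam 1 \<le> 1.62" "lam 2 \<le> 2.415" "lam 3 \<le> 3.303"
  "4.236 \<le> lam 4" "lam 4 \<le> 4.2361" "5.1925 \<le> lam 5" "lam 5 \<le> 5.1926"
proof -
  show "lam 1 \<le> 1.62" "lam 2 \<le> 2.415" "lam 3 \<le> 3.303" "lam 4 \<le> 4.2361" "lam 5 \<le> 5.1926"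
    by (rule lam_le; simp add: power2_eq_square)+
  show "4.236 \<le> lam 4" "5.1925 \<le> lam 5"
    by (rule lam_ge; simp add: power2_eq_square)+
qed

text \<open>Bounds the ratio of consecutive values by 6/5 once \<open>lam n \<ge> 5\<close>, which
  handles all digits above 5 at once.\<close>

lemma lam_Suc_le: "lam (Suc n) \<le> lam n + 1"
proof (rule lam_le)
  have "real n \<le> lam n" by (rule lam_ge) (simp add: power2_eq_square)
  thus "0 \<le> 2 * (lam n + 1) - real (Suc n)" by simp
  show "1 + real (Suc n) * (lam n + 1) \<le> (lam n + 1)\<^sup>2"
    using lam_square[of n] \<open>real n \<le> lam n\<close> by (simp add: power2_eq_square algebra_simps)
qed

section \<open>Chord bound for \<open>ln (lam n)\<close>\<close>

definition slope :: real where "slope = ln (lam 5) - ln (lam 4)"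

definition chord :: "nat \<Rightarrow> real" where
  "chord n = ln (lam 4) + (real n - 4) * slope"

lemma chord_45 [simp]: "chord 4 = ln (lam 4)" "chord 5 = ln (lam 5)"
  by (auto simp: chord_def slope_def)

lemma slope_bounds: "ln 1.225 \<le> slope" "slope \<le> ln 1.226"
proof -
  have s: "slope = ln (lam 5 / lam 4)"
    unfolding slope_def using lam_pos by (simp add: ln_div)
  have "1.225 \<le> lam 5 / lam 4" "lam 5 / lam 4 \<le> 1.226"
    using lam_bounds lam_pos[of 4] by (auto simp: field_simps)
  thus "ln 1.225 \<le> slope" "slope \<le> ln 1.226"
    unfolding s by (subst ln_le_cancel_iff; simp add: lam_pos)+
qed

lemma ln_ge_one_minus_inverse: "1 - 1 / r \<le> ln r" if "r > 0" for r :: real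
  using ln_le_minus_one[of "1 / r"] that by (simp add: ln_div)

text \<open>Concavity made explicit: above 5 each further digit adds at most
  \<open>ln (6 / 5)\<close>, which is less than \<open>slope\<close>; below 4 three numerical checks
  remain. The margin 1/1000 is what every loss is worth from here on.\<close>

lemma ln_lam_gap:
  assumes "n \<ge> 1" "n \<noteq> 4" "n \<noteq> 5"
  shows "ln (lam n) + 1 / 1000 \<le> chord n"
proof (cases "n \<ge> 6")
  case True
  have 1: "lam (5 + k) \<le> lam 5 * (6 / 5) ^ k" for k
  proof (induction k)
    case (Suc k)
    have "5 \<le> lam (5 + k)" by (intro lam_ge) (auto simp: power2_eq_square)
    hence "lam (5 + Suc k) \<le> lam (5 + k) * (6 / 5)" using lam_Suc_le[of "5 + k"] by simp
    also have "\<dots> \<le> lam 5 * (6 / 5) ^ k * (6 / 5)" using Suc by simp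
    finally show ?case by (simp add: mult_ac)
  qed simp
  define k where "k = n - 5"
  have k: "n = 5 + k" "k \<ge> 1" using True by (auto simp: k_def)
  have "ln (lam n) \<le> ln (lam 5 * (6 / 5) ^ k)"
    using 1[of k] lam_pos by (subst ln_le_cancel_iff) (auto simp: k)
  also have "\<dots> = ln (lam 5) + real k * ln (6 / 5)"
    using lam_pos by (simp add: ln_mult ln_realpow)
  finally have 2: "ln (lam n) \<le> ln (lam 5) + real k * ln (6 / 5)" .
  have "1 - 1 / (1.225 / 1.2) \<le> ln (1.225 / (1.2::real))"
    by (rule ln_ge_one_minus_inverse) simp
  also have "\<dots> = ln 1.225 - ln (6 / 5)" by (subst ln_div) auto
  finally have "slope - ln (6 / 5) \<ge> 1 / 1000" using slope_bounds by simp
  moreover from this have "real k * (slope - ln (6 / 5)) \<ge> 1 * (slope - ln (6 / 5))"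
    using k by (intro mult_right_mono) auto
  ultimately have "1 / 1000 \<le> real k * (slope - ln (6 / 5))"
    unfolding mult_1 by (rule order_trans)
  thus ?thesis using 2 unfolding chord_def by (simp add: k slope_def algebra_simps)
next
  case False
  \<comment> \<open>The claim for the digit \<open>4 - j\<close> in exponentiated form; the factor
    1.002 pays for the margin, as \<open>1 - 1 / 1.002 > 1 / 1000\<close>.\<close>
  have *: "ln u + 1 / 1000 \<le> ln (lam 4) - real j * slope"
    if "u > 0" "1.002 * u * 1.226 ^ j \<le> 4.236" for u j
  proof -
    have "ln (1.002 * u * 1.226 ^ j) \<le> ln (lam 4)"
      using that lam_bounds lam_pos by (subst ln_le_cancel_iff) auto
    moreover have "ln (c * u * d ^ j) = ln c + ln u + j * ln d" if "c > 0" "d > 0" for c d :: real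
      using that \<open>u > 0\<close> by (simp add: ln_mult ln_realpow)
    note this[of "1.002" "1.226"]
    moreover have "1 - 1 / 1.002 \<le> ln (1.002::real)"
      by (rule ln_ge_one_minus_inverse) simp
    moreover have "real j * slope \<le> real j * ln 1.226"
      using slope_bounds by (intro mult_left_mono) auto
    ultimately show ?thesis by (simp del: ln_le_cancel_iff)
  qed
  have "n = 1 \<or> n = 2 \<or> n = 3" using False assms by auto
  then consider "n = 1" | "n = 2" | "n = 3" by blast
  thus ?thesis
  proof cases
    case 1
    show ?thesis using *[of "lam 1" 3] lam_bounds lam_pos[of 1]
      by (simp add: chord_def 1 power3_eq_cube)
  next
    case 2
    show ?thesis using *[of "lam 2" 2] lam_bounds lam_pos[of 2]
      by (simp add: chord_def 2 power2_eq_square)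
  next
    case 3
    show ?thesis using *[of "lam 3" 1] lam_bounds lam_pos[of 3]
      by (simp add: chord_def 3)
  qed
qed

lemma ln_lam_le_chord: "ln (lam n) \<le> chord n" if "n \<ge> 1"
  using ln_lam_gap[OF that] by (cases "n = 4 \<or> n = 5") auto

section \<open>Accumulated losses against the chord bound\<close>

definition cf_norm :: "(nat \<Rightarrow> nat) \<Rightarrow> nat \<Rightarrow> real" where
  "cf_norm a n = (real (cf_den a (Suc n)))\<^sup>2 + (real (cf_den a n))\<^sup>2"

text \<open>The factor 2 matches the squared norm. The value starts at 0 and can only decrease; its
  negative is the total loss so far.\<close>

definition excess :: "(nat \<Rightarrow> nat) \<Rightarrow> nat \<Rightarrow> real" where
  "excess a n = ln (cf_norm a n) - 2 * (\<Sum>i = 1..n. chord (a i))"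

lemma cf_den_Suc_pos: "cf_den a (Suc n) \<ge> 1" if "\<forall>i\<ge>1. 1 \<le> a i"
proof (induction n)
  case (Suc n)
  have "1 \<le> a (Suc n) * cf_den a (Suc n)" using Suc that by simp
  thus ?case by (simp del: One_nat_def)
qed simp

lemma cf_norm_ge_1: "cf_norm a n \<ge> 1" if "\<forall>i\<ge>1. 1 \<le> a i"
proof -
  have "1 \<le> (real (cf_den a (Suc n)))\<^sup>2"
    using cf_den_Suc_pos[OF that, of n] by (intro one_le_power) simp
  thus ?thesis unfolding cf_norm_def by (simp add: add_increasing2)
qed

text \<open>The spectral norm bound, certified by a square that vanishes exactly on the eigenvector
  direction \<open>x = l * y\<close>.\<close>

lemma cf_norm_Suc_le: "cf_norm a (Suc n) \<le> (lam (a (Suc n)))\<^sup>2 * cf_norm a n"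
proof -
  define m l x y where "m = real (a (Suc n))" and "l = lam (a (Suc n))"
    and "x = real (cf_den a (Suc n))" and "y = real (cf_den a n)"
  have l: "l > 0" "l\<^sup>2 = m * l + 1" unfolding l_def m_def by (rule lam_pos lam_square)+
  have "l * (l\<^sup>2 * (x\<^sup>2 + y\<^sup>2) - ((m * x + y)\<^sup>2 + x\<^sup>2)) = m * (x - l * y)\<^sup>2"
    using l(2) by algebra
  moreover have "m * (x - l * y)\<^sup>2 \<ge> 0" by (simp add: m_def)
  ultimately have "l\<^sup>2 * (x\<^sup>2 + y\<^sup>2) - ((m * x + y)\<^sup>2 + x\<^sup>2) \<ge> 0"
    using l(1) by (metis zero_le_mult_iff not_less)
  thus ?thesis unfolding cf_norm_def by (simp add: m_def l_def x_def y_def)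
qed

text \<open>The squared Frobenius norm of the product of the matrices of the digits 4 and 5 is 483,
  slightly less than \<open>(lam 4 * lam 5)\<^sup>2\<close>.\<close>
lemma cf_norm_switch_le:
  assumes "{a (Suc n), a (Suc (Suc n))} = {4, 5}"
  shows "cf_norm a (Suc (Suc n)) \<le> 483 * cf_norm a n"
proof -
  define x y where "x = real (cf_den a (Suc n))" and "y = real (cf_den a n)"
  have "a (Suc n) = 4 \<and> a (Suc (Suc n)) = 5 \<or> a (Suc n) = 5 \<and> a (Suc (Suc n)) = 4"
    using assms by (auto simp: doubleton_eq_iff)
  moreover have "483 * (x\<^sup>2 + y\<^sup>2) - ((21 * x + 5 * y)\<^sup>2 + (4 * x + y)\<^sup>2) 
      = (21 * y - 5 * x)\<^sup>2 + (4 * y - x)\<^sup>2"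
    "483 * (x\<^sup>2 + y\<^sup>2) - ((21 * x + 4 * y)\<^sup>2 + (5 * x + y)\<^sup>2) 
      = (21 * y - 4 * x)\<^sup>2 + (5 * y - x)\<^sup>2"
    by (simp_all add: power2_eq_square algebra_simps)
  moreover have "(21 * y - 5 * x)\<^sup>2 + (4 * y - x)\<^sup>2 \<ge> 0" "(21 * y - 4 * x)\<^sup>2 + (5 * y - x)\<^sup>2 \<ge> 0"
    by simp_all
  ultimately have "(21 * x + 5 * y)\<^sup>2 + (4 * x + y)\<^sup>2 \<le> 483 * (x\<^sup>2 + y\<^sup>2)"
    "(21 * x + 4 * y)\<^sup>2 + (5 * x + y)\<^sup>2 \<le> 483 * (x\<^sup>2 + y\<^sup>2)" by linarith+
  thus ?thesis using \<open>_ \<or> _\<close> unfolding cf_norm_def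
    by (auto simp: x_def y_def algebra_simps)
qed

lemma excess_Suc:
  assumes "\<forall>i\<ge>1. 1 \<le> a i"
  shows "excess a (Suc n) \<le> excess a n - 2 * (chord (a (Suc n)) - ln (lam (a (Suc n))))"
proof -
  have "ln (cf_norm a (Suc n)) \<le> ln ((lam (a (Suc n)))\<^sup>2 * cf_norm a n)"
    using cf_norm_Suc_le[of a n] cf_norm_ge_1[OF assms, of n]
      cf_norm_ge_1[OF assms, of "Suc n"] lam_pos[of "a (Suc n)"]
    by (subst ln_le_cancel_iff) auto
  also have "\<dots> = 2 * ln (lam (a (Suc n))) + ln (cf_norm a n)"
    using cf_norm_ge_1[OF assms, of n] lam_pos[of "a (Suc n)"]
    by (simp add: ln_mult ln_realpow)
  finally show ?thesis unfolding excess_def by (simp add: algebra_simps)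
qed

lemma excess_antimono:
  assumes "\<forall>i\<ge>1. 1 \<le> a i" and "m \<le> n"
  shows "excess a n \<le> excess a m"
proof -
  have "excess a (Suc n) \<le> excess a n" for n
    using excess_Suc[of a n] ln_lam_le_chord[of "a (Suc n)"] assms(1)
    by force
  thus ?thesis using lift_Suc_antimono_le assms(2) by blast
qed

lemma excess_gap:
  assumes "\<forall>i\<ge>1. 1 \<le> a i" "a (Suc n) \<noteq> 4" "a (Suc n) \<noteq> 5"
  shows "excess a (Suc n) \<le> excess a n - 1 / 1000"
  using excess_Suc[of a n] ln_lam_gap[of "a (Suc n)"] assms by force

lemma excess_switch:
  assumes pos: "\<forall>i\<ge>1. 1 \<le> a i" and sw: "{a (Suc n), a (Suc (Suc n))} = {4, 5}"
  shows "excess a (Suc (Suc n)) \<le> excess a n - 1 / 1000"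
proof -
  have 1: "cf_norm a n \<ge> 1" "cf_norm a (Suc (Suc n)) \<ge> 1"
    using cf_norm_ge_1 pos by auto
  \<comment> \<open>The margin is thin: \<open>(4.236 * 5.1925)\<^sup>2\<close> is about 483.80 and
    \<open>483 * 1.0015\<close> about 483.72, which is why the eigenvalues are enclosed so
    tightly.\<close>
  have "4.236 * 5.1925 \<le> lam 4 * lam 5"
    using lam_bounds by (intro mult_mono) auto
  hence "(4.236 * 5.1925)\<^sup>2 \<le> (lam 4 * lam 5)\<^sup>2" by (rule power_mono) simp
  hence "483 * 1.0015 \<le> (lam 4 * lam 5)\<^sup>2" by (simp add: power2_eq_square)
  hence "ln (483 * 1.0015) \<le> ln ((lam 4 * lam 5)\<^sup>2)"
    using lam_pos[of 4] lam_pos[of 5] by (subst ln_le_cancel_iff) auto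
  also have "\<dots> = 2 * (ln (lam 4) + ln (lam 5))"
    using lam_pos by (simp add: ln_mult ln_realpow)
  finally have "ln 483 + ln 1.0015 \<le> 2 * (ln (lam 4) + ln (lam 5))"
    by (subst (asm) ln_mult) auto
  moreover have "1 - 1 / 1.0015 \<le> ln (1.0015::real)" by (rule ln_ge_one_minus_inverse) simp
  ultimately have 2: "ln 483 + 1 / 1000 \<le> 2 * (ln (lam 4) + ln (lam 5))" by simp
  have "ln (cf_norm a (Suc (Suc n))) \<le> ln (483 * cf_norm a n)"
    using cf_norm_switch_le[OF sw] 1 by (subst ln_le_cancel_iff) auto
  also have "\<dots> = ln 483 + ln (cf_norm a n)" using 1 by (subst ln_mult) auto
  finally have 3: "ln (cf_norm a (Suc (Suc n))) \<le> ln 483 + ln (cf_norm a n)" .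
  have "chord (a (Suc n)) + chord (a (Suc (Suc n))) = ln (lam 4) + ln (lam 5)"
    using sw by (auto simp: doubleton_eq_iff)
  thus ?thesis using 2 3 unfolding excess_def by (simp add: algebra_simps)
qed

text \<open>In a window that is neither all 4 nor all 5, some digit leaves \<open>{4, 5}\<close> or
  two neighbours switch between them. Monotonicity carries that loss to the ends of the
  window.\<close>

lemma excess_window:
  assumes pos: "\<forall>i\<ge>1. 1 \<le> a i"
    and nc: "\<not> (\<forall>i\<in>{m<..m+h}. a i = 4)" "\<not> (\<forall>i\<in>{m<..m+h}. a i = 5)"
  shows "excess a (m + h) \<le> excess a m - 1 / 1000"
proof (cases "\<forall>i\<in>{m<..m+h}. a i = 4 \<or> a i = 5")
  case False
  then obtain j where "j \<in> {m<..m+h}" "a j \<noteq> 4" "a j \<noteq> 5" by blast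
  then obtain i where i: "m \<le> i" "Suc i \<le> m + h" "a (Suc i) \<noteq> 4" "a (Suc i) \<noteq> 5"
    by (cases j) (auto simp: less_Suc_eq_le)
  have "excess a (m + h) \<le> excess a (Suc i)" using pos i by (intro excess_antimono) auto
  also have "\<dots> \<le> excess a i - 1 / 1000" using pos i by (intro excess_gap) auto
  also have "excess a i \<le> excess a m" using pos i by (intro excess_antimono) auto
  finally show ?thesis by simp
next
  case True
  have "\<exists>i. m < i \<and> Suc i \<le> m + h \<and> a i \<noteq> a (Suc i)"
  proof (rule ccontr)
    assume no: "\<not> ?thesis"
    have eq: "a (m + Suc k) = a (Suc m)" if "k < h" for k
      using that
    proof (induction k)
      case (Suc k)
      have "m < m + Suc k" "Suc (m + Suc k) \<le> m + h" using Suc.prems by auto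
      hence "a (m + Suc k) = a (Suc (m + Suc k))" using no by blast
      thus ?case using Suc by simp
    qed simp
    have const: "a i = a (Suc m)" if "i \<in> {m<..m+h}" for i
      using eq[of "i - Suc m"] that by auto
    have "h > 0" using nc(1) by (intro gr0I) auto
    hence "Suc m \<in> {m<..m+h}" by simp
    with True have "a (Suc m) = 4 \<or> a (Suc m) = 5" by (rule bspec)
    moreover have "\<forall>i\<in>{m<..m+h}. a i = a (Suc m)" using const by blast
    ultimately show False using nc by (elim disjE) simp_all
  qed
  then obtain j where j: "m < j" "Suc j \<le> m + h" "a j \<noteq> a (Suc j)" by blast
  \<comment> \<open>The switch loss is measured from index \<open>i = j - 1 \<ge> m\<close>, so it
    falls inside the window.\<close>
  then obtain i where ji: "j = Suc i" by (cases j) auto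
  have "j \<in> {m<..m+h}" "Suc j \<in> {m<..m+h}" using j by simp_all
  hence "a j = 4 \<or> a j = 5" "a (Suc j) = 4 \<or> a (Suc j) = 5" using True by blast+
  hence switch: "{a (Suc i), a (Suc (Suc i))} = {4, 5}" using j(3) by (elim disjE) (simp_all add: ji insert_commute)
  have "excess a (m + h) \<le> excess a (Suc (Suc i))" using pos j ji by (intro excess_antimono) auto
  also have "\<dots> \<le> excess a i - 1 / 1000" using excess_switch[OF pos switch] .
  also have "excess a i \<le> excess a m" using pos j ji by (intro excess_antimono) auto
  finally show ?thesis by simp
qed

section \<open>Convergents and the question mark function\<close>

definition convergent_of :: "(nat \<Rightarrow> nat) \<Rightarrow> nat \<Rightarrow> real" where
  "convergent_of a n = real (cf_num a (Suc n)) / real (cf_den a (Suc n))"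

lemma cf_det:
  "real (cf_num a n) * real (cf_den a (Suc n)) - real (cf_num a (Suc n)) * real (cf_den a n) = (-1) ^ n"
proof (induction n)
  case (Suc n)
  have "real (cf_num a (Suc n)) * real (cf_den a (Suc (Suc n)))
      - real (cf_num a (Suc (Suc n))) * real (cf_den a (Suc n))
    = - (real (cf_num a n) * real (cf_den a (Suc n)) - real (cf_num a (Suc n)) * real (cf_den a n))"
    by (simp add: algebra_simps)
  thus ?case using Suc by simp
qed simp

lemma cf_num_le_den: "\<forall>i\<ge>1. 1 \<le> a i \<Longrightarrow> cf_num a (Suc n) \<le> cf_den a (Suc n)"
proof (induction n rule: induct_nat_012)
  case (ge2 n)
  have "a (Suc (Suc n)) * cf_num a (Suc (Suc n)) \<le> a (Suc (Suc n)) * cf_den a (Suc (Suc n))"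
    using ge2 by (intro mult_le_mono) auto
  moreover have "cf_num a (Suc n) \<le> cf_den a (Suc n)" using ge2 by blast
  ultimately show ?case by (subst cf_num.simps, subst cf_den.simps) linarith
qed auto

lemma cf_den_ge: "\<forall>i\<ge>1. 1 \<le> a i \<Longrightarrow> n \<le> cf_den a (Suc n)"
proof (induction n rule: induct_nat_012)
  case (ge2 n)
  have "1 * cf_den a (Suc (Suc n)) \<le> a (Suc (Suc n)) * cf_den a (Suc (Suc n))"
    using ge2 by (intro mult_le_mono) auto
  moreover have "1 \<le> cf_den a (Suc n)" using cf_den_Suc_pos ge2 by blast
  moreover have "Suc n \<le> cf_den a (Suc (Suc n))" using ge2 by blast
  ultimately show ?case by (subst cf_den.simps) linarith
qed auto

lemma cf_den_Suc_mono: "\<forall>i\<ge>1. 1 \<le> a i \<Longrightarrow> cf_den a n \<le> cf_den a (Suc n)"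
proof (cases n)
  case (Suc m)
  assume "\<forall>i\<ge>1. 1 \<le> a i"
  hence "1 * cf_den a (Suc m) \<le> a (Suc m) * cf_den a (Suc m)"
    by (intro mult_le_mono) auto
  thus ?thesis unfolding Suc cf_den.simps by linarith
qed simp

section \<open>Values of \<open>?\<close> at convergents\<close>

definition adjacent :: "nat \<Rightarrow> nat \<Rightarrow> nat \<Rightarrow> nat \<Rightarrow> bool" where
  "adjacent p q p' q' \<longleftrightarrow> 1 \<le> q \<and> 1 \<le> q' \<and> p \<le> q \<and> p' \<le> q' \<and>
     (p' * q = p * q' + 1 \<or> p * q' = p' * q + 1)"

text \<open>Both orders of the two fractions are allowed, because consecutive convergents alternate
  around their limit.\<close>

lemma qm_mediant:
  assumes f: "is_minkowski_qm f" and adj: "adjacent p q p' q'"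
  shows "f (real (p + p') / real (q + q')) = (f (real p / real q) + f (real p' / real q')) / 2"
proof -
  have "farey_consecutive p q p' q' \<or> farey_consecutive p' q' p q"
    using adj det_farey_consecutive unfolding adjacent_def by blast
  thus ?thesis using f unfolding is_minkowski_qm_def of_nat_add
    by (metis add.commute)
qed

text \<open>Each mediant with the fixed fraction \<open>p / q\<close> stays adjacent to it and
  halves the remaining increment of \<open>f\<close>. A continued fraction digit \<open>j\<close> is
  a run of \<open>j\<close> such mediants.\<close>

lemma qm_ladder:
  assumes f: "is_minkowski_qm f" and adj: "adjacent p q p' q'"
  shows "f (real (j * p + p') / real (j * q + q')) - f (real p / real q)
    = (1 / 2) ^ j * (f (real p' / real q') - f (real p / real q))"
proof (induction j)
  case (Suc j)
  have "adjacent p q (j * p + p') (j * q + q')"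
    using adj by (auto simp: adjacent_def algebra_simps intro: add_mono)
  from qm_mediant[OF f this]
  have "f (real (Suc j * p + p') / real (Suc j * q + q')) - f (real p / real q)
    = (f (real (j * p + p') / real (j * q + q')) - f (real p / real q)) / 2"
    by (simp add: add.assoc field_simps)
  thus ?case using Suc by simp
qed simp

lemma convergents_adjacent:
  assumes "\<forall>i\<ge>1. 1 \<le> a i"
  shows "adjacent (cf_num a (Suc (Suc n))) (cf_den a (Suc (Suc n))) (cf_num a (Suc n)) (cf_den a (Suc n))"
proof -
  have "real (cf_num a (Suc n) * cf_den a (Suc (Suc n)))
      = real (cf_num a (Suc (Suc n)) * cf_den a (Suc n) + 1) \<or>
    real (cf_num a (Suc (Suc n)) * cf_den a (Suc n))
      = real (cf_num a (Suc n) * cf_den a (Suc (Suc n)) + 1)"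
    using cf_det[of a "Suc n"] unfolding of_nat_mult of_nat_add
    by (cases "even n") (auto simp del: cf_num.simps(3) cf_den.simps(3))
  thus ?thesis unfolding adjacent_def of_nat_eq_iff
    using assms cf_num_le_den[of a n] cf_num_le_den[of a "Suc n"] cf_den_Suc_pos[of a n]
      cf_den_Suc_pos[of a "Suc n"] by auto
qed

lemma qm_convergents_diff:
  assumes f: "is_minkowski_qm f" and pos: "\<forall>i\<ge>1. 1 \<le> a i"
  shows "f (convergent_of a (Suc n)) - f (convergent_of a n) = (-1) ^ n * 2 * (1 / 2) ^ (\<Sum>i = 1..Suc n. a i)"
proof (induction n)
  case 0
  \<comment> \<open>\<open>1 / a 1\<close> is reached from \<open>1 / 1\<close> by only
    \<open>a 1 - 1\<close> mediants with \<open>0 / 1\<close>; this is the origin of the factor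
    2.\<close>
  have "adjacent 0 1 1 1" by (simp add: adjacent_def)
  from qm_ladder[OF f this, of "a 1 - 1"] f pos
  have "f (1 / real (a 1)) = (1 / 2) ^ (a 1 - 1)"
    by (auto simp: is_minkowski_qm_def)
  moreover have "(1 / 2 :: real) ^ (a 1 - 1) = 2 * (1 / 2) ^ a 1"
    using pos[rule_format, of 1] by (cases "a 1") auto
  ultimately show ?case using f by (simp add: convergent_of_def is_minkowski_qm_def)
next
  case (Suc n)
  have "f (convergent_of a (Suc (Suc n))) - f (convergent_of a (Suc n))
    = (1 / 2) ^ a (Suc (Suc n)) * (f (convergent_of a n) - f (convergent_of a (Suc n)))"
    using qm_ladder[OF f convergents_adjacent[OF pos], of "a (Suc (Suc n))" n]
    unfolding convergent_of_def
    by (subst cf_num.simps(3) cf_den.simps(3), subst cf_den.simps(3))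
  thus ?case using Suc by (simp add: power_add algebra_simps)
qed

section \<open>Approximation errors of the convergents\<close>

abbreviation cf_tail :: "real \<Rightarrow> nat \<Rightarrow> real" where
  "cf_tail x n \<equiv> (gauss_map ^^ n) x"

definition cf_err :: "real \<Rightarrow> nat \<Rightarrow> real" where
  "cf_err x n = x * real (cf_den (cf_quot x) n) - real (cf_num (cf_quot x) n)"

context
  fixes x :: real
  assumes x: "x \<in> {0<..<1}" "x \<notin> \<rat>"
begin

text \<open>Irrationality passes to every tail, so no tail is 0 and the default value
  \<open>1 / 0 = 0\<close> never interferes.\<close>

lemma cf_tail_in: "cf_tail x n \<in> {0<..<1} \<and> cf_tail x n \<notin> \<rat>"
proof (induction n)
  case (Suc n)
  define y where "y = cf_tail x n"
  have y: "y \<notin> \<rat>" using Suc by (simp add: y_def)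
  have "1 / y \<notin> \<rat>"
  proof
    assume "1 / y \<in> \<rat>"
    hence "inverse (1 / y) \<in> \<rat>" by (rule Rats_inverse)
    thus False using y by simp
  qed
  have g: "gauss_map y \<notin> \<rat>"
  proof
    assume "gauss_map y \<in> \<rat>"
    hence "gauss_map y + of_int \<lfloor>1 / y\<rfloor> \<in> \<rat>" by (intro Rats_add) auto
    thus False using \<open>1 / y \<notin> \<rat>\<close> by (simp add: gauss_map_def frac_def)
  qed
  moreover from this have "gauss_map y \<noteq> 0" by (intro notI) simp
  moreover have "gauss_map y \<ge> 0" "gauss_map y < 1"
    by (simp_all add: gauss_map_def frac_lt_1)
  ultimately show ?case by (simp add: y_def)
qed (use x in auto)

lemma cf_tail_Suc: "1 / cf_tail x n = real (cf_quot x (Suc n)) + cf_tail x (Suc n)"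
proof -
  have "0 \<le> \<lfloor>1 / cf_tail x n\<rfloor>" using cf_tail_in[of n] by simp
  thus ?thesis by (simp add: cf_quot_def gauss_map_def frac_def)
qed

lemma cf_quot_pos: "\<forall>i\<ge>1. 1 \<le> cf_quot x i"
proof (intro allI impI)
  fix i :: nat assume "i \<ge> 1"
  have "1 \<le> 1 / cf_tail x (i - 1)" using cf_tail_in[of "i - 1"] by simp
  hence "1 \<le> \<lfloor>1 / cf_tail x (i - 1)\<rfloor>" by (subst le_floor_iff) simp
  thus "1 \<le> cf_quot x i" unfolding cf_quot_def by linarith
qed

text \<open>The errors obey the same linear recursion as numerators and denominators, and
  \<open>1 / y = a + z\<close> solves it. Alternating signs and decreasing sizes both follow from
  this ratio.\<close>

lemma cf_err_Suc: "cf_err x (Suc n) = - cf_tail x n * cf_err x n"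
proof (induction n)
  case 0
  show ?case by (simp add: cf_err_def)
next
  case (Suc n)
  define y z where "y = cf_tail x n" and "z = cf_tail x (Suc n)"
  have y: "y \<noteq> 0" "1 / y = real (cf_quot x (Suc n)) + z"
    using cf_tail_in[of n] cf_tail_Suc[of n] by (auto simp: y_def z_def)
  have "cf_err x (Suc (Suc n)) = real (cf_quot x (Suc n)) * cf_err x (Suc n) + cf_err x n"
    by (simp add: cf_err_def algebra_simps)
  also have "cf_err x n = - (1 / y) * cf_err x (Suc n)"
    using Suc y(1) by (simp add: y_def)
  also have "real (cf_quot x (Suc n)) * cf_err x (Suc n) + \<dots> = - z * cf_err x (Suc n)"
    unfolding y(2) by algebra
  finally have "cf_err x (Suc (Suc n)) = - z * cf_err x (Suc n)" .
  thus ?case by (simp add: z_def)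
qed

lemma cf_err_sign: "(-1) ^ n * cf_err x (Suc n) > 0"
proof (induction n)
  case 0
  show ?case using x by (simp add: cf_err_def)
next
  case (Suc n)
  have "(-1) ^ Suc n * cf_err x (Suc (Suc n)) = cf_tail x (Suc n) * ((-1) ^ n * cf_err x (Suc n))"
    by (subst cf_err_Suc) simp
  thus ?case using Suc cf_tail_in[of "Suc n"] by simp
qed

lemma abs_cf_err_less: "\<bar>cf_err x (Suc (Suc n))\<bar> < \<bar>cf_err x (Suc n)\<bar>"
proof -
  have "cf_err x (Suc n) \<noteq> 0" using cf_err_sign[of n] by auto
  thus ?thesis using cf_tail_in[of "Suc n"] by (subst cf_err_Suc) (simp add: abs_mult)
qed

lemma abs_cf_err_le_1: "\<bar>cf_err x (Suc n)\<bar> \<le> 1"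
proof (induction n)
  case 0
  show ?case using x by (simp add: cf_err_def)
next
  case (Suc n)
  thus ?case using abs_cf_err_less[of n] by linarith
qed

lemma err_convergent: "x - convergent_of (cf_quot x) n = cf_err x (Suc n) / real (cf_den (cf_quot x) (Suc n))"
  using cf_den_Suc_pos[OF cf_quot_pos, of n]
  by (simp add: convergent_of_def cf_err_def field_simps)

lemma convergent_sign: "(-1) ^ n * (x - convergent_of (cf_quot x) n) > 0"
  using cf_err_sign[of n] cf_den_Suc_pos[OF cf_quot_pos, of n] unfolding err_convergent
  by (simp only: times_divide_eq_right) (intro divide_pos_pos; simp)

lemma abs_err_convergent_less:
  "\<bar>x - convergent_of (cf_quot x) (Suc n)\<bar> < \<bar>x - convergent_of (cf_quot x) n\<bar>"
proof -
  have d: "1 \<le> cf_den (cf_quot x) (Suc n)" "cf_den (cf_quot x) (Suc n) \<le> cf_den (cf_quot x) (Suc (Suc n))"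
    by (intro cf_den_Suc_pos[OF cf_quot_pos] cf_den_Suc_mono[OF cf_quot_pos])+
  have "\<bar>x - convergent_of (cf_quot x) (Suc n)\<bar> 
      \<le> \<bar>cf_err x (Suc (Suc n))\<bar> / real (cf_den (cf_quot x) (Suc n))"
    unfolding err_convergent abs_divide abs_of_nat using d
    by (intro divide_left_mono mult_pos_pos) (auto simp del: cf_den.simps)
  also have "\<dots> < \<bar>cf_err x (Suc n)\<bar> / real (cf_den (cf_quot x) (Suc n))"
    using d abs_cf_err_less by (intro divide_strict_right_mono) (auto simp del: cf_den.simps)
  finally show ?thesis by (simp add: err_convergent)
qed

lemma convergent_of_tendsto: "convergent_of (cf_quot x) \<longlonglongrightarrow> x"
proof -
  have "(\<lambda>n. x - convergent_of (cf_quot x) n) \<longlonglongrightarrow> 0"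
  proof (rule Lim_null_comparison)
    show "\<forall>\<^sub>F n in sequentially. norm (x - convergent_of (cf_quot x) n) \<le> 1 / real n"
      using eventually_gt_at_top[of 0]
    proof eventually_elim
      case (elim n)
      have "real n \<le> real (cf_den (cf_quot x) (Suc n))"
        using cf_den_ge[OF cf_quot_pos, of n] by simp
      thus ?case using elim abs_cf_err_le_1[of n] unfolding err_convergent real_norm_def abs_divide abs_of_nat
        by (intro frac_le) auto
    qed
  qed (rule lim_1_over_n)
  from tendsto_diff[OF tendsto_const[of x] this] show ?thesis by simp
qed

lemma convergent_in: "convergent_of (cf_quot x) n \<in> {0..1}"
  using cf_num_le_den[OF cf_quot_pos, of n] cf_den_Suc_pos[OF cf_quot_pos, of n]
  by (auto simp: convergent_of_def)

lemma convergents_diff: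
  "convergent_of (cf_quot x) (Suc n) - convergent_of (cf_quot x) n =
     (-1) ^ n / (real (cf_den (cf_quot x) (Suc n)) * real (cf_den (cf_quot x) (Suc (Suc n))))"
  using cf_det[of "cf_quot x" "Suc n"] cf_den_Suc_pos[OF cf_quot_pos, of n]
    cf_den_Suc_pos[OF cf_quot_pos, of "Suc n"]
  unfolding convergent_of_def by (simp add: field_simps del: cf_num.simps(3) cf_den.simps(3))

end

section \<open>Lower bound for the deficit\<close>

definition eta :: real where "eta = ln 2 / 2 - slope"

lemma eta_bounds: "0.1 \<le> eta" "eta \<le> 1 / 2"
proof -
  have "1 - 1 / (2 / 1.226\<^sup>2) \<le> ln (2 / 1.226\<^sup>2 :: real)"
    by (rule ln_ge_one_minus_inverse) simp
  also have "\<dots> = ln 2 - 2 * ln 1.226" by (subst ln_div) (auto simp: ln_realpow)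
  finally show "0.1 \<le> eta" using slope_bounds by (simp add: eta_def power2_eq_square)
  have "0 \<le> ln (1.225 :: real)" by (rule ln_ge_zero) simp
  hence "0 \<le> slope" using slope_bounds(1) by (rule order_trans)
  moreover have "ln 2 \<le> (1::real)" using ln_le_minus_one[of "2::real"] by simp
  ultimately show "eta \<le> 1 / 2" by (simp add: eta_def)
qed

text \<open>Equivalently \<open>n * ln 2 / 2 - chord n = eta * (n - kappa2)\<close>:
  \<open>kappa2\<close> is where the line of slope \<open>ln (sqrt 2)\<close> through the origin
  meets the chord, and \<open>eta\<close> is the difference of the slopes.\<close>

lemma eta_kappa2: "eta * kappa2 = ln (lam 4) - 4 * slope"
proof -
  have "sqrt 20 = 2 * sqrt 5" by (simp flip: real_sqrt_mult add: real_sqrt_mult[of 4 5, simplified])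
  hence 4: "lam 4 = 2 + sqrt 5" by (simp add: lam_def)
  have 5: "lam 5 = (5 + sqrt 29) / 2" by (simp add: lam_def)
  have "ln (sqrt 2) = ln 2 / (2::real)" by (simp add: ln_sqrt)
  hence "kappa2 = (4 * ln (lam 5) - 5 * ln (lam 4)) / (- eta)"
    unfolding kappa2_def 4[symmetric] 5[symmetric] by (simp add: eta_def slope_def)
  also have "4 * ln (lam 5) - 5 * ln (lam 4) = - (ln (lam 4) - 4 * slope)"
    by (simp add: slope_def)
  finally have "kappa2 = - (ln (lam 4) - 4 * slope) / - eta" .
  moreover have "eta \<noteq> 0" using eta_bounds by auto
  ultimately show ?thesis by (simp add: field_simps)
qed

text \<open>The crossing lies strictly between 4 and 5 because \<open>lam 4 > 2\<^sup>2\<close> and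
  \<open>(lam 5)\<^sup>2 < 2 ^ 5\<close>; dividing these margins by \<open>eta \<le> 1 / 2\<close>
  gives the distance 0.1 from both ends.\<close>

lemma kappa2_bounds: "4.1 \<le> kappa2" "kappa2 \<le> 4.9"
proof -
  have "1 - 1 / (lam 4 / 4) \<le> ln (lam 4 / 4)" by (rule ln_ge_one_minus_inverse) simp
  also have "\<dots> = ln (lam 4) - ln (2\<^sup>2)" by (subst ln_div) auto
  finally have "1 - 4 / lam 4 \<le> ln (lam 4) - 2 * ln 2" by (subst (asm) ln_realpow) auto
  moreover have "4 / lam 4 \<le> 0.95" using lam_bounds by (simp add: field_simps)
  moreover have "eta * (kappa2 - 4) = ln (lam 4) - 2 * ln 2"
    unfolding right_diff_distrib eta_kappa2 by (simp add: eta_def)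
  ultimately have "0.05 \<le> eta * (kappa2 - 4)" by simp
  moreover have "eta * (kappa2 - 4) \<le> (1 / 2) * (kappa2 - 4)" if "kappa2 \<ge> 4"
    using that eta_bounds by (intro mult_right_mono) auto
  moreover have "eta * (kappa2 - 4) \<le> 0" if "kappa2 \<le> 4"
    using that eta_bounds by (intro mult_nonneg_nonpos) auto
  ultimately show "4.1 \<le> kappa2" by (cases "kappa2 \<ge> 4") auto
  have "1 - 1 / (2 ^ 5 / (lam 5)\<^sup>2) \<le> ln (2 ^ 5 / (lam 5)\<^sup>2)" by (rule ln_ge_one_minus_inverse) simp
  also have "\<dots> = ln (2 ^ 5) - ln ((lam 5)\<^sup>2)" by (subst ln_div) auto
  also have "\<dots> = 5 * ln 2 - 2 * ln (lam 5)" by (subst (1 2) ln_realpow) auto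
  finally have "1 - (lam 5)\<^sup>2 / 32 \<le> 5 * ln 2 - 2 * ln (lam 5)" by simp
  moreover have "(lam 5)\<^sup>2 \<le> 5.1926\<^sup>2" using lam_bounds by (intro power_mono) (auto intro: less_imp_le)
  ultimately have "0.1 \<le> 5 * ln 2 - 2 * ln (lam 5)" by (simp add: power2_eq_square)
  moreover have "eta * (5 - kappa2) = (5 * ln 2 - 2 * ln (lam 5)) / 2"
    unfolding right_diff_distrib eta_kappa2 by (simp add: eta_def slope_def field_simps)
  ultimately have "0.05 \<le> eta * (5 - kappa2)" by simp
  moreover have "eta * (5 - kappa2) \<le> (1 / 2) * (5 - kappa2)" if "kappa2 \<le> 5"
    using that eta_bounds by (intro mult_right_mono) auto
  moreover have "eta * (5 - kappa2) \<le> 0" if "kappa2 \<ge> 5"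
    using that eta_bounds by (intro mult_nonneg_nonpos) auto
  ultimately show "kappa2 \<le> 4.9" by (cases "kappa2 \<le> 5") auto
qed

section \<open>From an infinite derivative to a large deficit\<close>

definition deficit :: "(nat \<Rightarrow> nat) \<Rightarrow> nat \<Rightarrow> real" where
  "deficit a n = kappa2 * real n - (\<Sum>i = 1..n. real (a i))"

lemma deficit_0 [simp]: "deficit a 0 = 0"
  by (simp add: deficit_def)

lemma deficit_Suc: "deficit a (Suc n) = deficit a n + kappa2 - real (a (Suc n))"
  by (simp add: deficit_def algebra_simps)

lemma deficit_const_window:
  assumes "\<forall>i\<in>{m<..m+h}. a i = d"
  shows "deficit a (m + h) = deficit a m + real h * (kappa2 - real d)"
  using assms by (induction h) (auto simp: deficit_Suc algebra_simps)

text \<open>The crossing identity summed over the digits; it translates between the loss in the norm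
  and the deficit.\<close>

lemma sum_chord:
  "2 * (\<Sum>i = 1..n. chord (a i)) = ln 2 * (\<Sum>i = 1..n. real (a i)) + 2 * eta * deficit a n"
proof -
  have "(\<Sum>i = 1..n. chord (a i)) = real n * (ln (lam 4) - 4 * slope) + slope * (\<Sum>i = 1..n. real (a i))"
    by (induction n) (auto simp: chord_def algebra_simps)
  thus ?thesis unfolding eta_kappa2[symmetric] by (simp add: deficit_def eta_def algebra_simps)
qed

text \<open>Difference quotients that are eventually at least 1 suffice. Two consecutive convergents
  enclose \<open>x\<close>, so the bounds on both sides add up to one for their gap, where the
  increments of argument and function are known exactly. The norm enters by
  \<open>2 * u * v \<le> u\<^sup>2 + v\<^sup>2\<close>.\<close>

lemma deriv_pinfty_imp_den_large:
  assumes f: "is_minkowski_qm f" and x: "x \<in> {0<..<1}" "x \<notin> \<rat>" and d: "has_deriv_pinfty f x"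
  shows "\<forall>\<^sub>F n in sequentially. 2 ^ (\<Sum>i = 1..n. cf_quot x i) \<le> cf_norm (cf_quot x) n"
proof -
  let ?a = "cf_quot x" and ?c = "convergent_of (cf_quot x)"
  have "\<forall>\<^sub>F \<delta> in at 0. 1 \<le> (f (x + \<delta>) - f x) / \<delta>"
    using d unfolding has_deriv_pinfty_def filterlim_at_top by blast
  then obtain e where e: "e > 0" "\<And>\<delta>. \<delta> \<noteq> 0 \<Longrightarrow> \<bar>\<delta>\<bar> < e \<Longrightarrow> 1 \<le> (f (x + \<delta>) - f x) / \<delta>"
    unfolding eventually_at by (auto simp: dist_real_def)
  have left: "y - x \<ge> f y - f x" if "y < x" "\<bar>y - x\<bar> < e" for y
    using e(2)[of "y - x"] that by (simp add: field_simps)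
  have right: "y - x \<le> f y - f x" if "y > x" "\<bar>y - x\<bar> < e" for y
    using e(2)[of "y - x"] that by (simp add: field_simps)
  have near: "\<forall>\<^sub>F n in sequentially. \<bar>?c n - x\<bar> < e"
    using tendstoD[OF convergent_of_tendsto[OF x] e(1)] by (simp add: dist_real_def)
  hence "\<forall>\<^sub>F n in sequentially. \<bar>?c (Suc n) - x\<bar> < e"
    by (subst eventually_sequentially_Suc)
  with near have "\<forall>\<^sub>F n in sequentially. 2 ^ (\<Sum>i = 1..Suc n. ?a i) \<le> cf_norm ?a (Suc n)"
  proof eventually_elim
    case (elim n)
    define u v where "u = real (cf_den ?a (Suc n))" and "v = real (cf_den ?a (Suc (Suc n)))"
    define S where "S = (\<Sum>i = 1..Suc n. ?a i)"
    have uv: "u > 0" "v > 0" unfolding u_def v_def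
      using cf_den_Suc_pos[OF cf_quot_pos[OF x], of n] cf_den_Suc_pos[OF cf_quot_pos[OF x], of "Suc n"]
      by linarith+
    have sgn: "(-1) ^ n * (x - ?c n) > 0" "(-1) ^ Suc n * (x - ?c (Suc n)) > 0"
      using convergent_sign[OF x] by blast+
    have "(-1) ^ n * (?c (Suc n) - ?c n) \<le> (-1) ^ n * (f (?c (Suc n)) - f (?c n))"
    proof (cases "even n")
      case True
      hence "?c n < x" "x < ?c (Suc n)" using sgn by auto
      with left[of "?c n"] right[of "?c (Suc n)"] elim True show ?thesis by simp
    next
      case False
      hence "x < ?c n" "?c (Suc n) < x" using sgn by auto
      with right[of "?c n"] left[of "?c (Suc n)"] elim False show ?thesis by simp
    qed
    hence "1 / (u * v) \<le> 2 * (1 / 2) ^ S"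
      unfolding convergents_diff[OF x] qm_convergents_diff[OF f cf_quot_pos[OF x]]
      by (cases "even n") (simp_all add: u_def v_def S_def del: sum.cl_ivl_Suc cf_den.simps)
    hence "2 ^ S \<le> 2 * u * v" using uv by (simp add: field_simps)
    also have "\<dots> \<le> v\<^sup>2 + u\<^sup>2" using sum_squares_bound[of u v] by simp
    finally show ?case by (simp add: cf_norm_def u_def v_def S_def)
  qed
  thus ?thesis by (subst (asm) eventually_sequentially_Suc)
qed

lemma excess_lower_bound:
  assumes pos: "\<forall>i\<ge>1. 1 \<le> a i"
    and ev: "\<forall>\<^sub>F n in sequentially. 2 ^ (\<Sum>i = 1..n. a i) \<le> cf_norm a n"
  obtains C where "C \<ge> 0" "\<And>n. - 2 * eta * deficit a n - C \<le> excess a n"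
proof -
  obtain N where N: "\<And>n. n \<ge> N \<Longrightarrow> 2 ^ (\<Sum>i = 1..n. a i) \<le> cf_norm a n"
    using ev unfolding eventually_sequentially by blast
  \<comment> \<open>Absorbs the indices below \<open>N\<close>, where nothing is known beyond
    \<open>cf_norm a n \<ge> 1\<close>.\<close>
  define C where "C = ln 2 * (\<Sum>i = 1..N. real (a i))"
  have C0: "C \<ge> 0" unfolding C_def by (intro mult_nonneg_nonneg sum_nonneg) auto
  have "- 2 * eta * deficit a n - C \<le> excess a n" for n
  proof -
    have "ln 2 * (\<Sum>i = 1..n. real (a i)) - C \<le> ln (cf_norm a n)"
    proof (cases "n \<ge> N")
      case True
      have "ln (2 ^ (\<Sum>i = 1..n. a i)) \<le> ln (cf_norm a n)"
        using N[OF True] cf_norm_ge_1[OF pos, of n] by (subst ln_le_cancel_iff) auto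
      thus ?thesis using C0 by (simp add: ln_realpow mult.commute)
    next
      case False
      have "(\<Sum>i = 1..n. real (a i)) \<le> (\<Sum>i = 1..N. real (a i))"
        using False by (intro sum_mono2) auto
      hence "ln 2 * (\<Sum>i = 1..n. real (a i)) - C \<le> 0"
        unfolding C_def by (simp add: mult_left_mono)
      moreover have "0 \<le> ln (cf_norm a n)" using cf_norm_ge_1[OF pos, of n] by simp
      ultimately show ?thesis by linarith
    qed
    thus ?thesis unfolding excess_def sum_chord by simp
  qed
  with C0 show ?thesis using that by blast
qed

lemma max_deficit_ge:
  assumes pos: "\<forall>i\<ge>1. 1 \<le> a i"
    and C: "C \<ge> 0" "\<And>n. - 2 * eta * deficit a n - C \<le> excess a n"
  shows "\<forall>\<^sub>F t in sequentially. sqrt (real t) / 10 ^ 8 \<le> Max (deficit a ` {1..t})"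
proof -
  \<comment> \<open>\<open>10 * C\<close> dominates the lower bound \<open>- 5 * C\<close> for the
    deficit, which \<open>eta \<ge> 0.1\<close> yields as the excess is never positive.\<close>
  define B where "B = max 1 (10 * C)"
  have B: "1 \<le> B" "C \<le> B" "10 * C \<le> B" using C(1) by (auto simp: B_def)
  have ex_le: "excess a n \<le> 0" for n
    using excess_antimono[OF pos, of 0 n] by (simp add: excess_def cf_norm_def)
  have dlow: "- B \<le> deficit a n" for n
  proof (cases "deficit a n \<le> 0")
    case True
    have "0.2 * (- deficit a n) \<le> 2 * eta * (- deficit a n)"
      using True eta_bounds by (intro mult_right_mono) auto
    hence "- deficit a n \<le> 5 * C" using C(2)[of n] ex_le[of n] by simp
    thus ?thesis using B(3) C(1) by linarith
  qed (use B in linarith)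
  have "\<forall>\<^sub>F t in sequentially. real t > (10 ^ 8 * B)\<^sup>2"
    using filterlim_real_sequentially unfolding filterlim_at_top_dense by blast
  thus ?thesis
    using eventually_gt_at_top[of 0]
  proof eventually_elim
    case (elim t)
    define M where "M = sqrt (real t) / 10 ^ 8"
    have "10 ^ 8 * B < sqrt (real t)" using elim(1) by (rule real_less_rsqrt)
    hence MB: "B < M" by (simp add: M_def)
    have t: "real t = (10 ^ 8 * M)\<^sup>2" by (simp add: M_def)
    show ?case
    proof (rule ccontr)
      assume "\<not> ?thesis"
      hence "Max (deficit a ` {1..t}) < M" by (simp add: M_def)
      hence "deficit a n < M" if "n \<in> {1..t}" for n
        using that by (subst (asm) Max_less_iff) auto
      hence dM: "deficit a n < M" if "n \<le> t" for n
        using that MB B by (cases "n = 0") auto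
      \<comment> \<open>Along \<open>h\<close> equal digits 4 or 5 the deficit moves by at least
        \<open>0.1 * h \<ge> 2 * M\<close>, too much for values strictly between \<open>- M\<close>
        and \<open>M\<close>; so each window of this length contains a loss.\<close>
      define h where "h = nat \<lceil>20 * M\<rceil>"
      have h: "20 * M \<le> real h" "real h \<le> 20 * M + 1"
        unfolding h_def using MB B by linarith+
      have step: "excess a (m + h) \<le> excess a m - 1 / 1000" if m: "m + h \<le> t" for m
      proof -
        have "real h * 0.1 \<le> real h * (kappa2 - 4)" "real h * 0.1 \<le> real h * (5 - kappa2)"
          using kappa2_bounds by (intro mult_left_mono; simp)+
        hence "2 * M \<le> real h * (kappa2 - real 4)" "real h * (kappa2 - real 5) \<le> - (2 * M)"
          using h by (simp_all add: algebra_simps)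
        moreover have "deficit a (m + h) < M" "deficit a m < M" "- M < deficit a (m + h)" "- M < deficit a m"
          using dM[of "m + h"] dM[of m] dlow[of m] dlow[of "m + h"] m MB by linarith+
        ultimately show ?thesis
          using deficit_const_window[of m h a 4] deficit_const_window[of m h a 5]
          by (intro excess_window[OF pos]) auto
      qed
      have ex: "excess a (k * h) \<le> - real k / 1000" if "k * h \<le> t" for k
        using that
      proof (induction k)
        case 0
        show ?case by (simp add: excess_def cf_norm_def)
      next
        case (Suc k)
        thus ?case using step[of "k * h"] by (simp add: algebra_simps)
      qed
      define k where "k = t div h"
      have kh: "k * h \<le> t" unfolding k_def by simp
      have h0: "h > 0" using h MB B by (intro gr0I) auto
      have "t < (k + 1) * h" unfolding k_def using dividend_less_div_times[OF h0, of t] by simp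
      hence "real t < real ((k + 1) * h)" by (simp only: of_nat_less_iff)
      hence tk: "real t < (real k + 1) * real h" by (simp add: algebra_simps)
      have "2 * eta * deficit a (k * h) \<le> M"
      proof (cases "deficit a (k * h) \<ge> 0")
        case True
        hence "2 * eta * deficit a (k * h) \<le> 1 * deficit a (k * h)"
          using eta_bounds by (intro mult_right_mono) auto
        thus ?thesis using dM[OF kh] by linarith
      next
        case False
        hence "2 * eta * deficit a (k * h) \<le> 0"
          using eta_bounds by (intro mult_nonneg_nonpos) auto
        thus ?thesis using MB B by linarith
      qed
      \<comment> \<open>The \<open>k\<close> windows lose \<open>k / 1000\<close> in total, while
        the excess stays above \<open>- M - C\<close>.\<close>
      hence "real k \<le> 1000 * (M + C)" using C(2)[of "k * h"] ex[OF kh] by simp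
      moreover have "1 \<le> M" "C \<le> M" using MB B by linarith+
      ultimately have "real k + 1 \<le> 2001 * M" "real h \<le> 21 * M" using h by simp_all
      \<comment> \<open>Now \<open>t < 42021 * M\<^sup>2\<close>, although
        \<open>t = 10 ^ 16 * M\<^sup>2\<close>; the constant \<open>10 ^ 8\<close> leaves ample
        room.\<close>
      hence "(real k + 1) * real h \<le> (2001 * M) * (21 * M)" using MB B by (intro mult_mono) auto
      hence "(10 ^ 8 * M)\<^sup>2 < (2001 * M) * (21 * M)" using tk t by linarith
      hence "10 ^ 16 * (M * M) < 42021 * (M * M)" by (simp add: power2_eq_square)
      moreover have "42021 * (M * M) \<le> 10 ^ 16 * (M * M)" by (intro mult_right_mono) auto
      ultimately show False by linarith
    qed
  qed
qed

section \<open>Prescribed digits and sufficiency of large denominators\<close>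

primrec cf_approx :: "(nat \<Rightarrow> nat) \<Rightarrow> nat \<Rightarrow> nat \<Rightarrow> real" where
  "cf_approx a 0 k = 0"
| "cf_approx a (Suc n) k = 1 / (real (a (Suc k)) + cf_approx a n (Suc k))"

lemma cf_approx_in: "cf_approx a n k \<in> {0..1}" if "\<forall>i\<ge>1. 2 \<le> a i"
proof (induction n arbitrary: k)
  case (Suc n)
  have "2 \<le> real (a (Suc k))" using that by simp
  thus ?case using Suc[of "Suc k"] by auto
qed simp

text \<open>With digits at least 2 every map \<open>u \<mapsto> 1 / (d + u)\<close> contracts by the
  factor 1/4, so the truncations of every tail converge geometrically.\<close>

lemma cf_approx_step:
  assumes a: "\<forall>i\<ge>1. 2 \<le> a i"
  shows "\<bar>cf_approx a (Suc n) k - cf_approx a n k\<bar> \<le> (1 / 4) ^ n"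
proof (induction n arbitrary: k)
  case 0
  show ?case using cf_approx_in[OF a, of 1 k] by (auto simp del: cf_approx.simps(2))
next
  case (Suc n)
  define d u v where "d = real (a (Suc k))" and "u = cf_approx a (Suc n) (Suc k)"
    and "v = cf_approx a n (Suc k)"
  have d: "2 \<le> d" using a by (simp add: d_def)
  have uv: "0 \<le> u" "0 \<le> v" unfolding u_def v_def
    using cf_approx_in[OF a] by (simp_all del: cf_approx.simps(2))
  have "2 * 2 \<le> (d + u) * (d + v)" using d uv by (intro mult_mono) auto
  hence "\<bar>v - u\<bar> / ((d + u) * (d + v)) \<le> \<bar>v - u\<bar> / 4" by (intro divide_left_mono) auto
  moreover have "1 / (d + u) - 1 / (d + v) = (v - u) / ((d + u) * (d + v))"
    using d uv by (simp add: field_simps)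
  ultimately have "\<bar>1 / (d + u) - 1 / (d + v)\<bar> \<le> \<bar>v - u\<bar> / 4"
    using d uv by (simp add: abs_mult)
  also have "\<bar>v - u\<bar> = \<bar>u - v\<bar>" by (rule abs_minus_commute)
  also have "\<dots> / 4 \<le> (1 / 4) ^ n / 4"
    using Suc[of "Suc k"] unfolding u_def v_def by (intro divide_right_mono) auto
  finally show ?case by (simp add: d_def u_def v_def)
qed

lemma cf_values_exist:
  assumes a: "\<forall>i\<ge>1. 2 \<le> a i"
  obtains y where "\<And>k. y k \<in> {0<..<1}" "\<And>k. 1 / y k = real (a (Suc k)) + y (Suc k)"
proof -
  have "\<exists>l. (\<lambda>n. cf_approx a n k) \<longlonglongrightarrow> l" for k
  proof -
    have "summable (\<lambda>n. cf_approx a (Suc n) k - cf_approx a n k)"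
    proof (rule summable_comparison_test')
      show "summable (\<lambda>n. (1 / 4 :: real) ^ n)" by (rule summable_geometric) simp
      show "norm (cf_approx a (Suc n) k - cf_approx a n k) \<le> (1 / 4) ^ n" for n
        using cf_approx_step[OF a] unfolding real_norm_def .
    qed
    hence "convergent (\<lambda>n. \<Sum>i<n. cf_approx a (Suc i) k - cf_approx a i k)"
      by (simp only: summable_iff_convergent)
    moreover have "(\<lambda>n. \<Sum>i<n. cf_approx a (Suc i) k - cf_approx a i k) = (\<lambda>n. cf_approx a n k)"
      using sum_lessThan_telescope[of "\<lambda>i. cf_approx a i k"] by simp
    ultimately show ?thesis by (simp add: convergent_def)
  qed
  then obtain y where y: "\<And>k. (\<lambda>n. cf_approx a n k) \<longlonglongrightarrow> y k" by metis
  have in01: "0 \<le> cf_approx a n k" "cf_approx a n k \<le> 1" for n k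
    using cf_approx_in[OF a, of n k] by simp_all
  have y01: "0 \<le> y k" "y k \<le> 1" for k
    by (rule LIMSEQ_le_const[OF y], blast intro: in01) (rule LIMSEQ_le_const2[OF y], blast intro: in01)
  have a2: "2 \<le> real (a (Suc k))" for k using a by simp
  have eq: "y k = 1 / (real (a (Suc k)) + y (Suc k))" for k
  proof (rule LIMSEQ_unique)
    show "(\<lambda>n. cf_approx a (Suc n) k) \<longlonglongrightarrow> y k" using y by (rule LIMSEQ_Suc)
    show "(\<lambda>n. cf_approx a (Suc n) k) \<longlonglongrightarrow> 1 / (real (a (Suc k)) + y (Suc k))"
      using a2[of k] y01(1)[of "Suc k"] unfolding cf_approx.simps
      by (intro tendsto_intros y) linarith
  qed
  show ?thesis
  proof
    fix k
    have pos: "real (a (Suc k)) + y (Suc k) > 1" using a2[of k] y01(1)[of "Suc k"] by linarith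
    show "1 / y k = real (a (Suc k)) + y (Suc k)" by (subst eq) simp
    show "y k \<in> {0<..<1}" using pos by (subst eq) auto
  qed
qed

lemma cf_expansion_exists:
  assumes a: "\<forall>i\<ge>1. 2 \<le> a i"
  obtains x where "x \<in> {0<..<1}" "x \<notin> \<rat>" "\<And>i. i \<ge> 1 \<Longrightarrow> cf_quot x i = a i"
proof -
  obtain y where y: "\<And>k. y k \<in> {0<..<1}" "\<And>k. 1 / y k = real (a (Suc k)) + y (Suc k)"
    using cf_values_exist[OF a] by blast
  have floor: "\<lfloor>1 / y k\<rfloor> = int (a (Suc k))" for k
    using y(1)[of "Suc k"] unfolding y(2) by (intro floor_unique) auto
  have tail: "cf_tail (y 0) k = y k" for k
  proof (induction k)
    case (Suc k)
    have "frac (1 / y k) = y (Suc k)" unfolding frac_def floor by (simp add: y(2))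
    thus ?case using Suc by (simp add: gauss_map_def)
  qed simp
  \<comment> \<open>Infinite descent: a tail equal to \<open>p / q\<close> forces the next tail to
    be a fraction with the smaller denominator \<open>p\<close>.\<close>
  have irr: "\<forall>k p. p > 0 \<longrightarrow> y k \<noteq> real p / real q" for q
  proof (induction q rule: less_induct)
    case (less q)
    show ?case
    proof (intro allI impI notI)
      fix k p assume p: "0 < p" and yk: "y k = real p / real q"
      have q: "q > 0" using y(1)[of k] yk by (intro gr0I) auto
      have "p < q" using y(1)[of k] q unfolding yk by (simp add: field_simps)
      have "y (Suc k) = (real q - real (a (Suc k)) * real p) / real p"
        using y(2)[of k] p unfolding yk by (simp add: field_simps)
      moreover from this have "0 < real q - real (a (Suc k)) * real p"
        using y(1)[of "Suc k"] p by (simp add: zero_less_divide_iff)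
      hence "real (a (Suc k) * p) < real q" by simp
      hence "a (Suc k) * p < q" by (simp only: of_nat_less_iff)
      ultimately have "y (Suc k) = real (q - a (Suc k) * p) / real p" "q - a (Suc k) * p > 0"
        by (simp_all add: of_nat_diff)
      thus False using less \<open>p < q\<close> by blast
    qed
  qed
  show ?thesis
  proof
    show "y 0 \<in> {0<..<1}" by (rule y)
    show "y 0 \<notin> \<rat>"
    proof
      assume "y 0 \<in> \<rat>"
      then obtain p q :: nat where "q \<noteq> 0" "\<bar>y 0\<bar> = real p / real q"
        using Rats_abs_nat_div_natE by metis
      hence "y 0 = real p / real q" "p > 0" using y(1)[of 0] by (auto intro: gr0I)
      thus False using irr by blast
    qed
    show "cf_quot (y 0) i = a i" if "i \<ge> 1" for i
      using that tail[of "i - 1"] floor[of "i - 1"] by (simp add: cf_quot_def)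
  qed
qed

text \<open>Here \<open>y\<close> lies between the convergents \<open>i\<close> and
  \<open>i + 2\<close>, on the same side of \<open>x\<close>. Its distance from \<open>x\<close> is
  at most the gap of the convergents \<open>i\<close> and \<open>i + 1\<close>, and by monotonicity
  \<open>f\<close> changes at least as much as between the convergents \<open>i + 2\<close> and
  \<open>i + 4\<close>, whose values are known.\<close>

lemma quotient_lower_bound:
  assumes f: "is_minkowski_qm f" and x: "x \<in> {0<..<1}" "x \<notin> \<rat>" and y: "y \<in> {0..1}" "y \<noteq> x"
    and side: "(-1) ^ i * (x - y) > 0"
    and far: "\<bar>x - convergent_of (cf_quot x) (Suc (Suc i))\<bar> \<le> \<bar>x - y\<bar>"
    and near: "\<bar>x - y\<bar> < \<bar>x - convergent_of (cf_quot x) i\<bar>"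
  shows "(1 / 2) ^ (\<Sum>j = 1..i + 3. cf_quot x j)
      * (real (cf_den (cf_quot x) (Suc i)) * real (cf_den (cf_quot x) (Suc (Suc i))))
    \<le> (f y - f x) / (y - x)"
proof -
  let ?a = "cf_quot x" and ?c = "convergent_of (cf_quot x)"
  define q where "q = real (cf_den ?a (Suc i)) * real (cf_den ?a (Suc (Suc i)))"
  define S where "S = (\<Sum>j = 1..i + 3. ?a j)"
  have q: "q > 0" unfolding q_def
    using cf_den_Suc_pos[OF cf_quot_pos[OF x], of i] cf_den_Suc_pos[OF cf_quot_pos[OF x], of "Suc i"]
    by (intro mult_pos_pos) linarith+
  have sgn: "(-1) ^ n * (x - ?c n) > 0" for n by (rule convergent_sign[OF x])
  \<comment> \<open>The increments to \<open>i + 3\<close> and on to \<open>i + 4\<close> have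
    opposite signs, and the second is at most half the first.\<close>
  have diff: "(-1) ^ i * (f (?c (i + 4)) - f (?c (i + 2))) \<ge> (1 / 2) ^ S"
  proof -
    have "f (?c (i + 4)) - f (?c (i + 3)) = - ((-1) ^ i * 2 * (1 / 2) ^ (S + ?a (i + 4)))"
      "f (?c (i + 3)) - f (?c (i + 2)) = (-1) ^ i * 2 * (1 / 2) ^ S"
      using qm_convergents_diff[OF f cf_quot_pos[OF x], of "i + 3"]
        qm_convergents_diff[OF f cf_quot_pos[OF x], of "i + 2"]
      by (simp_all add: S_def eval_nat_numeral add_ac)
    hence "f (?c (i + 4)) - f (?c (i + 2))
        = (-1) ^ i * (2 * (1 / 2) ^ S - 2 * (1 / 2) ^ (S + ?a (i + 4)))"
      by (simp add: algebra_simps)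
    hence "(-1) ^ i * (f (?c (i + 4)) - f (?c (i + 2))) = 2 * (1 / 2) ^ S - 2 * (1 / 2) ^ (S + ?a (i + 4))"
      by (cases "even i") simp_all
    moreover have "(1 / 2 :: real) ^ (S + ?a (i + 4)) \<le> (1 / 2) ^ (S + 1)"
      using cf_quot_pos[OF x] by (intro power_decreasing) auto
    ultimately show ?thesis by simp
  qed
  have len: "(-1) ^ i * (x - ?c i) \<le> 1 / q"
  proof -
    have "(-1) ^ i * (?c (Suc i) - ?c i) = 1 / q"
      unfolding convergents_diff[OF x] q_def by (cases "even i") simp_all
    moreover have "(-1) ^ i * (?c (Suc i) - x) \<ge> 0" using sgn[of "Suc i"] by (simp add: algebra_simps)
    ultimately show ?thesis by (simp add: algebra_simps)
  qed
  have sm: "f u \<le> f v" if "u \<in> {0..1}" "v \<in> {0..1}" "u \<le> v" for u v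
    using f that unfolding is_minkowski_qm_def by (metis strict_mono_onD less_eq_real_def)
  note in01 = convergent_in[OF x]
  have x01: "x \<in> {0..1}" using x by simp
  have "(1 / 2) ^ S * \<bar>y - x\<bar> \<le> (1 / 2) ^ S * (1 / q)"
  proof (intro mult_left_mono)
    show "\<bar>y - x\<bar> \<le> 1 / q" using near len sgn[of i] by (cases "even i") auto
  qed simp
  also have "\<dots> \<le> (1 / q) * ((-1) ^ i * (f (?c (i + 4)) - f (?c (i + 2))))"
    using diff q by (subst mult.commute, intro mult_left_mono) auto
  also have "\<dots> \<le> (1 / q) * \<bar>f y - f x\<bar>"
  proof (intro mult_left_mono)
    show "(-1) ^ i * (f (?c (i + 4)) - f (?c (i + 2))) \<le> \<bar>f y - f x\<bar>"
    proof (cases "even i")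
      case True
      hence "y \<le> ?c (i + 2)" "?c (i + 4) \<le> x" "y \<le> x"
        using side far sgn[of "i + 2"] sgn[of "i + 4"] by auto
      hence "f y \<le> f (?c (i + 2))" "f (?c (i + 4)) \<le> f x" "f y \<le> f x"
        using y x01 in01 by (auto intro: sm)
      thus ?thesis using True by simp
    next
      case False
      hence "y \<ge> ?c (i + 2)" "?c (i + 4) \<ge> x" "y \<ge> x"
        using side far sgn[of "i + 2"] sgn[of "i + 4"] by auto
      hence "f y \<ge> f (?c (i + 2))" "f (?c (i + 4)) \<ge> f x" "f y \<ge> f x"
        using y x01 in01 by (auto intro: sm)
      thus ?thesis using False by simp
    qed
  qed (use q in simp)
  finally have "(1 / 2) ^ S * q * \<bar>y - x\<bar> \<le> \<bar>f y - f x\<bar>"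
    using q by (simp add: field_simps)
  hence "(1 / 2) ^ S * q \<le> \<bar>f y - f x\<bar> / \<bar>y - x\<bar>"
    using y(2) by (simp add: pos_le_divide_eq)
  also have "\<dots> = (f y - f x) / (y - x)"
    using sm[of x y] sm[of y x] x01 y by (cases "x \<le> y") (auto simp: abs_if divide_simps algebra_simps)
  finally show ?thesis unfolding S_def q_def .
qed

lemma deriv_pinfty_if_den_large:
  assumes f: "is_minkowski_qm f" and x: "x \<in> {0<..<1}" "x \<notin> \<rat>"
    and R: "filterlim (\<lambda>i. (1 / 2) ^ (\<Sum>j = 1..i + 3. cf_quot x j)
      * (real (cf_den (cf_quot x) (Suc i)) * real (cf_den (cf_quot x) (Suc (Suc i))))) at_top sequentially"
  shows "has_deriv_pinfty f x"
  unfolding has_deriv_pinfty_def filterlim_at_top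
proof
  fix Z :: real
  let ?c = "convergent_of (cf_quot x)"
  obtain N where N: "\<And>i. i \<ge> N \<Longrightarrow> Z \<le> (1 / 2) ^ (\<Sum>j = 1..i + 3. cf_quot x j)
      * (real (cf_den (cf_quot x) (Suc i)) * real (cf_den (cf_quot x) (Suc (Suc i))))"
    using R unfolding filterlim_at_top eventually_sequentially by blast
  have anti: "\<bar>x - ?c n\<bar> \<le> \<bar>x - ?c m\<bar>" if "m \<le> n" for m n
    using lift_Suc_antimono_le[of "\<lambda>n. \<bar>x - ?c n\<bar>" m n] that abs_err_convergent_less[OF x]
    by (simp add: less_imp_le)
  have sgn: "(-1) ^ n * (x - ?c n) > 0" for n by (rule convergent_sign[OF x])
  define d where "d = \<bar>x - ?c (Suc N)\<bar>"
  have "d > 0" using sgn[of "Suc N"] unfolding d_def by auto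
  have "Z \<le> (f (x + \<delta>) - f x) / \<delta>" if \<delta>: "\<delta> \<noteq> 0" "\<bar>\<delta>\<bar> < d" for \<delta>
  proof -
    define y where "y = x + \<delta>"
    have near: "\<bar>x - y\<bar> < \<bar>x - ?c i\<bar>" if "i \<le> Suc N" for i
      using anti[OF that] \<delta> by (simp add: y_def d_def)
    \<comment> \<open>Being closer to \<open>x\<close> than the convergents \<open>N\<close> and
      \<open>N + 1\<close>, \<open>y\<close> lies between them; outside the unit interval
      \<open>f\<close> would be unspecified.\<close>
    have y01: "y \<in> {0..1}"
    proof (cases "even N")
      case True
      hence "?c N < y" "y < ?c (Suc N)"
        using near[of N] near[of "Suc N"] sgn[of N] sgn[of "Suc N"] by auto
      thus ?thesis using convergent_in[OF x, of N] convergent_in[OF x, of "Suc N"] by auto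
    next
      case False
      hence "?c (Suc N) < y" "y < ?c N"
        using near[of N] near[of "Suc N"] sgn[of N] sgn[of "Suc N"] by auto
      thus ?thesis using convergent_in[OF x, of N] convergent_in[OF x, of "Suc N"] by auto
    qed
    \<comment> \<open>\<open>P k\<close> says that convergent \<open>k\<close> lies on the side of
      \<open>y\<close> and is no farther from \<open>x\<close>. For the least such \<open>k\<close>,
      which is at least \<open>N + 2\<close>, the convergent \<open>k - 2\<close> lies beyond
      \<open>y\<close>.\<close>
    define P where "P k \<longleftrightarrow> (-1) ^ k * (x - y) > 0 \<and> \<bar>x - ?c k\<bar> \<le> \<bar>x - y\<bar>" for k
    have "\<exists>k. P k"
    proof -
      have "\<forall>\<^sub>F n in sequentially. \<bar>x - ?c n\<bar> < \<bar>\<delta>\<bar>"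
        using tendstoD[OF convergent_of_tendsto[OF x], of "\<bar>\<delta>\<bar>"] \<delta>(1)
        by (simp add: dist_real_def abs_minus_commute)
      then obtain n where n: "\<And>m. m \<ge> n \<Longrightarrow> \<bar>x - ?c m\<bar> < \<bar>\<delta>\<bar>"
        unfolding eventually_sequentially by blast
      have "\<bar>x - y\<bar> = \<bar>\<delta>\<bar>" by (simp add: y_def)
      moreover have "(-1) ^ n * (x - y) > 0 \<or> (-1) ^ Suc n * (x - y) > 0"
        using \<delta>(1) by (cases "even n") (auto simp: y_def)
      ultimately show ?thesis unfolding P_def
        using n[of n] n[of "Suc n"] by (metis le_refl le_SucI less_imp_le)
    qed
    define k where "k = (LEAST k. P k)"
    have Pk: "P k" unfolding k_def using \<open>\<exists>k. P k\<close> by (rule LeastI_ex)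
    have "k \<ge> N + 2"
    proof (rule ccontr)
      assume "\<not> k \<ge> N + 2"
      thus False using near[of k] Pk unfolding P_def by simp
    qed
    then obtain i where i: "k = Suc (Suc i)" "i \<ge> N" by (metis add_2_eq_Suc' Suc_le_D Suc_le_mono)
    have side: "(-1) ^ i * (x - y) > 0" using Pk unfolding P_def i by simp
    have "\<not> P i" unfolding k_def using not_less_Least[of i P] i(1) k_def by simp
    hence "\<bar>x - y\<bar> < \<bar>x - ?c i\<bar>" using side unfolding P_def by simp
    moreover have "\<bar>x - ?c (Suc (Suc i))\<bar> \<le> \<bar>x - y\<bar>" using Pk unfolding P_def i by blast
    ultimately have "Z \<le> (f y - f x) / (y - x)"
      using quotient_lower_bound[OF f x y01 _ side] N[OF i(2)] \<delta>(1) by (force simp: y_def)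
    thus ?thesis by (simp add: y_def)
  qed
  thus "\<forall>\<^sub>F \<delta> in at 0. Z \<le> (f (x + \<delta>) - f x) / \<delta>"
    unfolding eventually_at using \<open>d > 0\<close> by (intro exI[of _ d]) (auto simp: dist_real_def)
qed

section \<open>The extremal digit sequence\<close>

text \<open>Since \<open>(lam d, 1)\<close> is an eigenvector of the matrix of the digit \<open>d\<close>, appending \<open>d\<close> multiplies
  this form by exactly \<open>lam d\<close>; only a change of the next digit from 5 to 4 loses something.\<close>

definition eigen_form :: "(nat \<Rightarrow> nat) \<Rightarrow> nat \<Rightarrow> real" where
  "eigen_form a n = lam (a (Suc n)) * real (cf_den a (Suc n)) + real (cf_den a n)"

lemma eigen_form_pos: "eigen_form a n > 0" if "\<forall>i\<ge>1. 1 \<le> a i"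
  unfolding eigen_form_def using cf_den_Suc_pos[OF that, of n] by (intro add_pos_nonneg mult_pos_pos) auto

text \<open>The form with the old weight grows exactly by \<open>lam\<close>. Passing to the weight
  of the next digit loses nothing if that digit is not smaller, and at most the factor
  \<open>lam 5 / lam 4\<close> on a drop from 5 to 4.\<close>

lemma eigen_form_step:
  assumes pos: "\<forall>i\<ge>1. 1 \<le> a i" and b: "a (Suc n) \<in> {4, 5}" "a (Suc (Suc n)) \<in> {4, 5}"
  shows "ln (eigen_form a n) + chord (a (Suc n))
      - (if a (Suc (Suc n)) < a (Suc n) then slope else 0) \<le> ln (eigen_form a (Suc n))"
proof -
  define l l' x y where "l = lam (a (Suc n))" and "l' = lam (a (Suc (Suc n)))"
    and "x = real (cf_den a (Suc (Suc n)))" and "y = real (cf_den a (Suc n))"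
  have l: "l > 0" "l' > 0" by (simp_all add: l_def l'_def)
  have 0: "eigen_form a (Suc n) = l' * x + y"
    by (simp add: eigen_form_def l'_def x_def y_def)
  have 1: "l * eigen_form a n = l * x + y"
  proof -
    have "l * eigen_form a n = l\<^sup>2 * y + l * real (cf_den a n)"
      by (simp add: eigen_form_def l_def y_def power2_eq_square algebra_simps)
    also have "\<dots> = l * x + y"
      using lam_square[of "a (Suc n)"] by (simp add: l_def x_def y_def algebra_simps)
    finally show ?thesis .
  qed
  have ch: "chord (a (Suc n)) = ln l" using b(1) unfolding l_def by auto
  have lnG: "ln (l * eigen_form a n) = ln l + ln (eigen_form a n)"
    using l eigen_form_pos[OF pos, of n] by (subst ln_mult) auto
  have xy: "x \<ge> 0" "y > 0" using cf_den_Suc_pos[OF pos, of n] by (simp_all add: x_def y_def)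
  show ?thesis
  proof (cases "a (Suc (Suc n)) < a (Suc n)")
    case False
    hence "l \<le> l'" using b lam_bounds by (auto simp: l_def l'_def)
    hence "l * x + y \<le> l' * x + y" using xy by (intro add_mono mult_right_mono) auto
    hence "ln (l * eigen_form a n) \<le> ln (eigen_form a (Suc n))"
      unfolding 0 1 using l xy by (subst ln_le_cancel_iff) (auto intro!: add_nonneg_pos)
    thus ?thesis using False lnG ch by simp
  next
    case True
    hence eq: "l = lam 5" "l' = lam 4" using b by (auto simp: l_def l'_def)
    have "lam 4 * y \<le> lam 5 * y" using lam_bounds xy by (intro mult_right_mono) auto
    hence "l' * (l * x + y) \<le> l * (l' * x + y)" by (simp add: eq algebra_simps)
    hence "ln (l' * (l * x + y)) \<le> ln (l * (l' * x + y))"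
      using l xy by (subst ln_le_cancel_iff) (auto intro!: add_nonneg_pos mult_pos_pos)
    hence "ln l' + ln (l * eigen_form a n) \<le> ln l + ln (eigen_form a (Suc n))"
      unfolding 0 1 using l xy by (simp add: ln_mult add_nonneg_pos[of _ y] less_imp_neq[symmetric])
    thus ?thesis using True lnG ch by (simp add: eq slope_def)
  qed
qed

text \<open>Block \<open>s\<close> has length \<open>2 * s + 1\<close>, so that it starts at index \<open>s\<^sup>2\<close>; the state is the current
  block and the position in it. The number of fours is chosen such that every late block raises
  the deficit by about 10, which outweighs the constant loss at the end of the block.\<close>

primrec block_state :: "nat \<Rightarrow> nat \<times> nat" where
  "block_state 0 = (0, 0)"
| "block_state (Suc n) = (case block_state n of (s, j) \<Rightarrow> if j < 2 * s then (s, Suc j) else (Suc s, 0))"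

definition fours :: "nat \<Rightarrow> nat" where
  "fours s = nat \<lceil>(2 * real s + 1) * (5 - kappa2)\<rceil> + 10"

definition block_digit :: "nat \<Rightarrow> nat" where
  "block_digit n = (case block_state (n - 1) of (s, j) \<Rightarrow> if j < fours s then 4 else 5)"

section \<open>Deficit and denominators of the block digits\<close>

lemma block_state_index: "block_state n = (s, j) \<Longrightarrow> j \<le> 2 * s \<and> n = s\<^sup>2 + j"
proof (induction n arbitrary: s j)
  case (Suc n)
  obtain s' j' where st: "block_state n = (s', j')" by fastforce
  show ?case using Suc.IH[OF st] Suc.prems st
    by (auto split: if_splits simp: power2_eq_square)
qed simp

lemma block_digit_45: "block_digit i \<in> {4, 5}"
  by (auto simp: block_digit_def split: prod.splits)

lemma block_digit_pos: "\<forall>i\<ge>1. 1 \<le> block_digit i"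
proof (intro allI impI)
  show "1 \<le> block_digit i" for i using block_digit_45[of i] by auto
qed

lemma fours_bounds:
  "(2 * real s + 1) * (5 - kappa2) + 10 \<le> real (fours s)"
  "real (fours s) \<le> (2 * real s + 1) * (5 - kappa2) + 11"
proof -
  have "(2 * real s + 1) * (5 - kappa2) \<ge> 0" using kappa2_bounds by simp
  thus "(2 * real s + 1) * (5 - kappa2) + 10 \<le> real (fours s)"
    "real (fours s) \<le> (2 * real s + 1) * (5 - kappa2) + 11"
    unfolding fours_def by linarith+
qed

text \<open>The change of the deficit over the first \<open>j\<close> digits of block
  \<open>s\<close>: a proportion \<open>5 - kappa2\<close> of fours would balance it. In small
  blocks \<open>fours s\<close> exceeds the length, and the block is all fours.\<close>

definition block_part :: "nat \<Rightarrow> nat \<Rightarrow> real" where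
  "block_part s j = min (real j) (real (fours s)) - real j * (5 - kappa2)"

lemma block_part_bounds: "0 \<le> block_part s j \<and> block_part s j \<le> real j" if "j \<le> 2 * s + 1"
proof -
  have "real j * (5 - kappa2) \<le> (2 * real s + 1) * (5 - kappa2)"
    using that kappa2_bounds by (intro mult_right_mono) auto
  moreover have "real j * (5 - kappa2) \<le> real j * 1"
    by (rule mult_left_mono) (use kappa2_bounds in auto)
  moreover have "0 \<le> real j * (5 - kappa2)" using kappa2_bounds by simp
  ultimately show ?thesis using fours_bounds(1)[of s] unfolding block_part_def by auto
qed

lemma block_part_Suc:
  "block_part s (Suc j) = block_part s j + kappa2 - (if j < fours s then 4 else 5)"
  unfolding block_part_def by (auto simp: min_def algebra_simps)

lemma block_part_full:
  "block_part s (2 * s + 1) \<le> 11" "55 \<le> s \<Longrightarrow> 10 \<le> block_part s (2 * s + 1)"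
proof -
  have r: "real (2 * s + 1) = 2 * real s + 1" by simp
  show "block_part s (2 * s + 1) \<le> 11"
    using fours_bounds(2)[of s] unfolding block_part_def r by linarith
  assume "55 \<le> s"
  \<comment> \<open>From block 55 on the length is at least 111, so even a block of fours only, at a
    rate of at least 0.1 per digit, gains 10.\<close>
  hence "111 * 0.1 \<le> (2 * real s + 1) * (kappa2 - 4)"
    using kappa2_bounds by (intro mult_mono) auto
  thus "10 \<le> block_part s (2 * s + 1)"
    using fours_bounds(1)[of s] unfolding block_part_def r by (simp add: min_def algebra_simps)
qed

text \<open>Each completed block adds between 0 and 11, and at least 10 from block 55 on; 550
  accounts for the 55 blocks before.\<close>

lemma deficit_block_digit:
  "block_state n = (s, j) \<Longrightarrow>
    block_part s j \<le> deficit block_digit n \<and>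
    10 * real s - 550 + block_part s j \<le> deficit block_digit n \<and>
    deficit block_digit n \<le> 11 * real s + block_part s j"
proof (induction n arbitrary: s j)
  case 0
  thus ?case by (simp add: block_part_def)
next
  case (Suc n)
  obtain s' j' where st: "block_state n = (s', j')" by fastforce
  note IH = Suc.IH[OF st]
  have j': "j' \<le> 2 * s'" using block_state_index[OF st] by simp
  have "real (block_digit (Suc n)) = (if j' < fours s' then 4 else 5)"
    by (simp add: block_digit_def st)
  hence D: "deficit block_digit (Suc n) - block_part s' (Suc j') = deficit block_digit n - block_part s' j'"
    unfolding deficit_Suc block_part_Suc by simp
  show ?case
  proof (cases "j' < 2 * s'")
    case True
    hence "s = s'" "j = Suc j'" using Suc.prems st by auto
    thus ?thesis using IH D by auto
  next
    case False
    hence "s = Suc s'" "j = 0" "j' = 2 * s'" using Suc.prems st j' by auto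
    moreover have "block_part s 0 = 0" by (simp add: block_part_def)
    moreover have "0 \<le> block_part s' (2 * s' + 1)" using block_part_bounds by blast
    ultimately show ?thesis using IH D block_part_full[of s'] by (cases "55 \<le> s'") auto
  qed
qed

lemma eigen_form_block_digit:
  "block_state n = (s, j) \<Longrightarrow>
    (\<Sum>i = 1..n. chord (block_digit i)) - real s * slope \<le> ln (eigen_form block_digit n)"
proof (induction n arbitrary: s j)
  case 0
  have "1 \<le> lam (block_digit 1)"
    using block_digit_45[of 1] lam_bounds by auto
  thus ?case using 0 by (simp add: eigen_form_def)
next
  case (Suc n)
  obtain s' j' where st: "block_state n = (s', j')" by fastforce
  note pos = block_digit_pos
  have d1: "block_digit (Suc n) = (if j' < fours s' then 4 else 5)"
    by (simp add: block_digit_def st)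
  have d2: "block_digit (Suc (Suc n)) = (if j < fours s then 4 else 5)"
    using Suc.prems by (simp add: block_digit_def)
  have "0 \<le> ln (1.225 :: real)" by (rule ln_ge_zero) simp
  hence slope: "0 \<le> slope" using slope_bounds(1) by (rule order_trans)
  \<comment> \<open>Digits never decrease inside a block, so \<open>slope\<close> is charged only
    when the block number advances.\<close>
  have "real s' * slope + (if block_digit (Suc (Suc n)) < block_digit (Suc n) then slope else 0)
    \<le> real s * slope"
  proof (cases "j' < 2 * s'")
    case True
    hence "s = s'" "j = Suc j'" using Suc.prems st by auto
    thus ?thesis using d1 d2 by auto
  next
    case False
    hence "s = Suc s'" using Suc.prems st by auto
    thus ?thesis using slope by (simp add: algebra_simps)
  qed
  thus ?case using Suc.IH[OF st] eigen_form_step[OF pos block_digit_45 block_digit_45, of n] by simp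
qed

lemma block_state_fst_ge: "sqrt (real n) - 1 \<le> real (fst (block_state n))"
proof -
  obtain s j where st: "block_state n = (s, j)" by fastforce
  have "n \<le> (s + 1)\<^sup>2" using block_state_index[OF st] by (auto simp: power2_eq_square)
  hence "real n \<le> real ((s + 1)\<^sup>2)" by (simp only: of_nat_le_iff)
  hence "real n \<le> (real s + 1)\<^sup>2" by (simp add: add.commute)
  hence "sqrt (real n) \<le> real s + 1" by (intro real_le_lsqrt) auto
  thus ?thesis by (simp add: st)
qed

text \<open>The deficit gains \<open>2 * s - 110\<close> after multiplication by
  \<open>2 * eta \<ge> 0.2\<close>, the switches cost at most \<open>2 * s * slope \<le> s\<close>,
  and the balance \<open>s - 110\<close> is at least \<open>sqrt n - 111\<close>. Replacing the
  eigenform by the denominator costs a factor 7.\<close>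

lemma block_digit_den_large:
  "ln 2 * (\<Sum>i = 1..n. real (block_digit i)) + sqrt (real n) - 111 - 2 * ln 7
    \<le> 2 * ln (real (cf_den block_digit (Suc n)))"
proof -
  obtain s j where st: "block_state n = (s, j)" by fastforce
  note pos = block_digit_pos
  define q where "q = real (cf_den block_digit (Suc n))"
  have q: "q \<ge> 1" using cf_den_Suc_pos[OF pos, of n] by (simp add: q_def)
  have "lam (block_digit (Suc n)) \<le> 6" using block_digit_45[of "Suc n"] lam_bounds by auto
  hence "lam (block_digit (Suc n)) * q \<le> 6 * q" using q by (intro mult_right_mono) auto
  moreover have "real (cf_den block_digit n) \<le> q"
    using cf_den_Suc_mono[OF pos, of n] unfolding q_def by (simp only: of_nat_le_iff)
  ultimately have "eigen_form block_digit n \<le> 7 * q" by (simp add: eigen_form_def q_def)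
  hence "ln (eigen_form block_digit n) \<le> ln (7 * q)"
    using q eigen_form_pos[OF pos, of n] by (subst ln_le_cancel_iff) auto
  also have "\<dots> = ln 7 + ln q" using q by (subst ln_mult) auto
  finally have 1: "(\<Sum>i = 1..n. chord (block_digit i)) - real s * slope \<le> ln 7 + ln q"
    using eigen_form_block_digit[OF st] by simp
  have D: "0 \<le> deficit block_digit n" "10 * real s - 550 \<le> deficit block_digit n"
    using deficit_block_digit[OF st] block_part_bounds[of j s] block_state_index[OF st] by auto
  have "0.2 * deficit block_digit n \<le> 2 * eta * deficit block_digit n"
    using D(1) eta_bounds by (intro mult_right_mono) auto
  hence 2: "2 * real s - 110 \<le> 2 * eta * deficit block_digit n" using D(2) by simp
  have "slope \<le> 0.5" using slope_bounds(2) ln_le_minus_one[of "1.226 :: real"] by simp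
  hence "real s * slope \<le> real s * 0.5" by (intro mult_left_mono) auto
  hence 3: "2 * (real s * slope) \<le> real s" by simp
  have 4: "sqrt (real n) - 1 \<le> real s" using block_state_fst_ge[of n] by (simp add: st)
  show ?thesis using 1 2 3 4 sum_chord[of block_digit n] unfolding q_def[symmetric] by linarith
qed

lemma block_digit_quotient_at_top:
  "filterlim (\<lambda>i. (1 / 2) ^ (\<Sum>j = 1..i + 3. block_digit j)
      * (real (cf_den block_digit (Suc i)) * real (cf_den block_digit (Suc (Suc i))))) at_top sequentially"
proof -
  \<comment> \<open>The summand \<open>15 * ln 2\<close> pays for the three extra digits, each at
    most 5.\<close>
  define K where "K = 111 + 2 * ln 7 + 15 * ln (2::real)"
  note pos = block_digit_pos
  have le: "sqrt (real i) - K \<le> (1 / 2) ^ (\<Sum>j = 1..i + 3. block_digit j)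
      * (real (cf_den block_digit (Suc i)) * real (cf_den block_digit (Suc (Suc i))))" (is "_ \<le> ?R") for i
  proof -
    define q q' where "q = real (cf_den block_digit (Suc i))" and "q' = real (cf_den block_digit (Suc (Suc i)))"
    have "1 \<le> q" using cf_den_Suc_pos[OF pos, of i] by (simp add: q_def)
    moreover have "q \<le> q'"
      using cf_den_Suc_mono[OF pos, of "Suc i"] unfolding q_def q'_def by (simp only: of_nat_le_iff)
    ultimately have q: "1 \<le> q" "q \<le> q'" .
    have R: "?R = (1 / 2) ^ (\<Sum>j = 1..i + 3. block_digit j) * (q * q')" by (simp only: q_def q'_def)
    have "block_digit j \<le> 5" for j using block_digit_45[of j] by auto
    hence "(\<Sum>j = 1..i + 3. block_digit j) \<le> (\<Sum>j = 1..i. block_digit j) + 15"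
      using add_mono[OF add_mono[of "block_digit (i + 1)" 5 "block_digit (i + 2)" 5], of "block_digit (i + 3)" 5]
      by (simp add: eval_nat_numeral)
    hence S: "real (\<Sum>j = 1..i + 3. block_digit j) \<le> (\<Sum>j = 1..i. real (block_digit j)) + 15"
      by (simp flip: of_nat_sum)
    have "ln q \<le> ln q'" using q by (subst ln_le_cancel_iff) auto
    moreover have "ln ?R = - (ln 2 * real (\<Sum>j = 1..i + 3. block_digit j)) + (ln q + ln q')"
      unfolding R using q by (simp add: ln_mult ln_realpow ln_div)
    moreover have "ln 2 * real (\<Sum>j = 1..i + 3. block_digit j) \<le> ln 2 * ((\<Sum>j = 1..i. real (block_digit j)) + 15)"
      using S by (intro mult_left_mono) auto
    ultimately have "sqrt (real i) - K \<le> ln ?R"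
      using block_digit_den_large[of i] unfolding K_def q_def[symmetric] by (simp add: algebra_simps)
    also have "\<dots> \<le> ?R - 1" by (rule ln_le_minus_one) (use q R in simp)
    finally show ?thesis by linarith
  qed
  show ?thesis unfolding filterlim_at_top
  proof
    fix Z :: real
    have "\<forall>\<^sub>F i in sequentially. (Z + K)\<^sup>2 \<le> real i"
      using filterlim_real_sequentially unfolding filterlim_at_top by blast
    thus "\<forall>\<^sub>F i in sequentially. Z \<le> (1 / 2) ^ (\<Sum>j = 1..i + 3. block_digit j)
      * (real (cf_den block_digit (Suc i)) * real (cf_den block_digit (Suc (Suc i))))"
    proof eventually_elim
      case (elim i)
      have "Z + K \<le> sqrt (real i)" using elim by (rule real_le_rsqrt)
      thus ?case using le[of i] by linarith
    qed
  qed
qed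

lemma deficit_block_digit_le: "deficit block_digit n \<le> 200 * sqrt (real n)"
proof -
  obtain s j where st: "block_state n = (s, j)" by fastforce
  have "s\<^sup>2 \<le> n" using block_state_index[OF st] by simp
  hence "real (s\<^sup>2) \<le> real n" by (simp only: of_nat_le_iff)
  hence "real s \<le> sqrt (real n)" by (intro real_le_rsqrt) simp
  \<comment> \<open>At most 11 from each completed block, and at most \<open>j \<le> 2 * s\<close>
    from the current one.\<close>
  moreover have "deficit block_digit n \<le> 13 * real s"
    using deficit_block_digit[OF st] block_part_bounds[of j s] block_state_index[OF st] by auto
  ultimately show ?thesis by simp
qed

lemma cf_den_cong: "(\<And>i. i \<ge> 1 \<Longrightarrow> a i = b i) \<Longrightarrow> cf_den a n = cf_den b n"
  by (induction n rule: induct_nat_012) auto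

theorem theorem4:
  shows "(\<forall>x::real. x \<in> {0<..<1} \<and> x \<notin> \<rat> \<and> has_deriv_pinfty minkowski_qm x \<longrightarrow>
            (\<forall>\<^sub>F t in sequentially.
               Max ((\<lambda>u. kappa2 * real u - real (cf_sum x u)) ` {1..t}) \<ge> sqrt (real t) / 10 ^ 8))
       \<and> (\<exists>x::real. x \<in> {0<..<1} \<and> x \<notin> \<rat> \<and> has_deriv_pinfty minkowski_qm x \<and>
            (\<forall>\<^sub>F t in sequentially.
               kappa2 * real t - real (cf_sum x t) \<le> 200 * sqrt (real t)))"
proof (intro conjI allI impI)
  have deficit_eq: "kappa2 * real u - real (cf_sum x u) = deficit (cf_quot x) u" for x u
    by (simp add: deficit_def cf_sum_def)
  note qm = is_minkowski_qm_minkowski_qm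
  {
    fix x :: real
    assume x: "x \<in> {0<..<1} \<and> x \<notin> \<rat> \<and> has_deriv_pinfty minkowski_qm x"
    have pos: "\<forall>i\<ge>1. 1 \<le> cf_quot x i" using x by (intro cf_quot_pos) auto
    have "\<forall>\<^sub>F n in sequentially. 2 ^ (\<Sum>i = 1..n. cf_quot x i) \<le> cf_norm (cf_quot x) n"
      using x by (intro deriv_pinfty_imp_den_large[OF qm]) auto
    then obtain C where "C \<ge> 0" "\<And>n. - 2 * eta * deficit (cf_quot x) n - C \<le> excess (cf_quot x) n"
      using excess_lower_bound[OF pos] by blast
    from max_deficit_ge[OF pos this]
    show "\<forall>\<^sub>F t in sequentially.
        Max ((\<lambda>u. kappa2 * real u - real (cf_sum x u)) ` {1..t}) \<ge> sqrt (real t) / 10 ^ 8"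
      unfolding deficit_eq .
  }
  have "\<forall>i\<ge>1. 2 \<le> block_digit i"
  proof (intro allI impI)
    show "2 \<le> block_digit i" for i using block_digit_45[of i] by auto
  qed
  then obtain x where x: "x \<in> {0<..<1}" "x \<notin> \<rat>"
    and dig: "\<And>i. i \<ge> 1 \<Longrightarrow> cf_quot x i = block_digit i"
    using cf_expansion_exists by blast
  have "has_deriv_pinfty minkowski_qm x"
  proof (rule deriv_pinfty_if_den_large[OF qm x])
    have "cf_den (cf_quot x) n = cf_den block_digit n" for n using dig by (rule cf_den_cong)
    moreover have "(\<Sum>j = 1..m. cf_quot x j) = (\<Sum>j = 1..m. block_digit j)" for m
      by (intro sum.cong) (auto simp: dig)
    ultimately show "filterlim (\<lambda>i. (1 / 2) ^ (\<Sum>j = 1..i + 3. cf_quot x j)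
      * (real (cf_den (cf_quot x) (Suc i)) * real (cf_den (cf_quot x) (Suc (Suc i))))) at_top sequentially"
      using block_digit_quotient_at_top by (simp only:)
  qed
  moreover have "deficit (cf_quot x) t = deficit block_digit t" for t
    unfolding deficit_def by (simp add: dig)
  hence "\<forall>\<^sub>F t in sequentially. kappa2 * real t - real (cf_sum x t) \<le> 200 * sqrt (real t)"
    unfolding deficit_eq using deficit_block_digit_le by simp
  ultimately show "\<exists>x::real. x \<in> {0<..<1} \<and> x \<notin> \<rat> \<and> has_deriv_pinfty minkowski_qm x \<and>
      (\<forall>\<^sub>F t in sequentially. kappa2 * real t - real (cf_sum x t) \<le> 200 * sqrt (real t))"
    using x by blast
qed

end
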